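(* Let $\mathcal{H}:\mathsf{M}\to\mathsf{N}$ be a functor with right adjoint $\mathcal{K}$, unit $\eta$ and counit $\xi$; let $\mathcal{C}$ be a comonad on $\mathsf{M}$ and $\mathcal{D}$ a comonad on $\mathsf{N}$; let $\sigma:\mathcal{H}\mathcal{C}\to\mathcal{D}\mathcal{H}$ be a natural transformation such that $(\mathcal{H},\sigma):(\mathsf{M},\mathcal{C})\to(\mathsf{N},\mathcal{D})$ is a colax morphism of comonads. Let $\tau:\mathcal{C}\mathcal{K}\to\mathcal{K}\mathcal{D}$ be the mate of $\sigma$, and let $\sigma':\mathcal{C}^{\vee}\to\mathcal{D}$ be the transformation associated with $\sigma$ by the universal property of the conjugate comonad $\mathcal{C}^{\vee}=\mathcal{H}\mathcal{C}\mathcal{K}$. Assume: (a) any parallel pair in $\mathsf{M}$ which is coreflexive and $\mathcal{H}$-split has an equalizer in $\mathsf{M}$; (b) $\mathcal{H}$ preserves the equalizer of any such pair; (c) $\mathcal{H}$ is conservative; (d) $\mathcal{C}$ and $\mathcal{C}^2$ preserve the equalizer of any parallel pair in $\mathsf{M}$ which is both coreflexive and $\mathcal{H}$-split. Then the functors $$\mathcal{H}_{\sigma}:\mathsf{M}_{\mathcal{C}}\rightleftarrows\mathsf{N}_{\mathcal{D}}:\mathcal{K}^{\tau}$$ form an adjoint equivalence if and only if the transformation $\sigma':\mathcal{C}^{\vee}\to\mathcal{D}$ is invertible.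
   Context: A functor is conservative if it reflects isomorphisms. A parallel pair $f,g:X\rightrightarrows Y$ is coreflexive if there is $r:Y\to X$ with $rf=\mathrm{id}=rg$. A split cofork is a diagram $E\xrightarrow{e}X\rightrightarrows Y$ (parallel arrows $f,g$) with $fe=ge$ for which there exist $p:X\to E$ and $q:Y\to X$ with $pe=\mathrm{id}$, $qf=\mathrm{id}$, $ep=qg$. A pair is $\mathcal{H}$-split if its image under $\mathcal{H}$ is part of a split cofork. The structure of every comonad is denoted $(\delta,\epsilon)$; $\mathsf{M}_{\mathcal{C}}$ is the category of $\mathcal{C}$-coalgebras. $(\mathcal{H},\sigma)$ is a colax morphism of comonads if $(\delta\mathcal{H})\circ\sigma=(\mathcal{D}\sigma)\circ(\sigma\mathcal{C})\circ(\mathcal{H}\delta)$ and $(\epsilon\mathcal{H})\circ\sigma=\mathcal{H}\epsilon$. The mate of $\sigma$ is $\tau=(\mathcal{K}\mathcal{D}\xi)\circ(\mathcal{K}\sigma\mathcal{K})\circ(\eta\mathcal{C}\mathcal{K})$. The conjugate comonad $\mathcal{C}^{\vee}=\mathcal{H}\mathcal{C}\mathcal{K}$ has comultiplication $(\mathcal{H}\mathcal{C}\eta\mathcal{C}\mathcal{K})\circ(\mathcal{H}\delta\mathcal{K})$ and counit $\xi\circ(\mathcal{H}\epsilon\mathcal{K})$. The transformation $\sigma'$ is the unique one with $(\sigma'\mathcal{H})\circ(\mathcal{H}\mathcal{C}\eta)=\sigma$; explicitly $\sigma'=(\mathcal{D}\xi)\circ(\sigma\mathcal{K}):\mathcal{H}\mathcal{C}\mathcal{K}\to\mathcal{D}\mathcal{H}\mathcal{K}\to\mathcal{D}$.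 The functor $\mathcal{H}_\sigma$ sends $(M,c)$ to $(\mathcal{H}(M),\sigma_M\circ\mathcal{H}(c))$ and acts as $\mathcal{H}$ on morphisms. For a $\mathcal{D}$-coalgebra $(N,d)$, $\mathcal{K}^{\tau}(N,d)$ is the equalizer in $\mathsf{M}_{\mathcal{C}}$ of the pair of morphisms of (cofree) $\mathcal{C}$-coalgebras $$\mathcal{C}\mathcal{K}(N)\xrightarrow{\delta_{\mathcal{K}(N)}}\mathcal{C}\mathcal{C}\mathcal{K}(N)\xrightarrow{\mathcal{C}(\tau_N)}\mathcal{C}\mathcal{K}\mathcal{D}(N)\quad\text{and}\quad\mathcal{C}\mathcal{K}(N)\xrightarrow{\mathcal{C}\mathcal{K}(d)}\mathcal{C}\mathcal{K}\mathcal{D}(N).$$ The functor $\mathcal{K}^\tau$ is defined when these equalizers exist for all $(N,d)$; the assertion that $\mathcal{H}_\sigma$ and $\mathcal{K}^\tau$ form an adjoint equivalence includes that existence. When $\mathcal{K}^\tau$ is defined, it is right adjoint to $\mathcal{H}_\sigma$ as follows: the unit at $(M,c)$ is the unique coalgebra morphism $(M,c)\to\mathcal{K}^\tau\mathcal{H}_\sigma(M,c)$ whose composite with the canonical map to $\mathcal{C}\mathcal{K}\mathcal{H}(M)$ is $\mathcal{C}(\eta_M)\circ c$; the counit at $(N,d)$ is $\mathcal{H}$ of the canonical map $\mathcal{K}^\tau(N,d)\to\mathcal{C}\mathcal{K}(N)$ followed by $\mathcal{H}(\epsilon_{\mathcal{K}(N)})$ and $\xi_N$. *)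

theory Defs
  imports Main
begin

section \<open>Categories, functors, natural transformations\<close>

record ('o, 'a) cat =
  Obj :: "'o set"
  Arr :: "'a set"
  Dom :: "'a \<Rightarrow> 'o"
  Cod :: "'a \<Rightarrow> 'o"
  Id :: "'o \<Rightarrow> 'a"
  Comp :: "'a \<Rightarrow> 'a \<Rightarrow> 'a"  (infixl "\<cdot>\<index>" 70)

definition hom :: "('o, 'a) cat \<Rightarrow> 'o \<Rightarrow> 'o \<Rightarrow> 'a set" where
  "hom A X Y = {f \<in> Arr A. Dom A f = X \<and> Cod A f = Y}"

locale category =
  fixes A :: "('o, 'a) cat" (structure)
  assumes dom_obj: "f \<in> Arr A \<Longrightarrow> Dom A f \<in> Obj A"
    and cod_obj: "f \<in> Arr A \<Longrightarrow> Cod A f \<in> Obj A"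
    and id_hom: "X \<in> Obj A \<Longrightarrow> Id A X \<in> hom A X X"
    and comp_hom: "f \<in> hom A X Y \<Longrightarrow> g \<in> hom A Y Z \<Longrightarrow> g \<cdot> f \<in> hom A X Z"
    and id_left: "f \<in> hom A X Y \<Longrightarrow> Id A Y \<cdot> f = f"
    and id_right: "f \<in> hom A X Y \<Longrightarrow> f \<cdot> Id A X = f"
    and assoc: "f \<in> hom A W X \<Longrightarrow> g \<in> hom A X Y \<Longrightarrow> h \<in> hom A Y Z
      \<Longrightarrow> (h \<cdot> g) \<cdot> f = h \<cdot> (g \<cdot> f)"

definition iso :: "('o, 'a) cat \<Rightarrow> 'a \<Rightarrow> bool" where
  "iso A f \<longleftrightarrow> f \<in> Arr A \<and>
     (\<exists>g \<in> hom A (Cod A f) (Dom A f).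
        g \<cdot>\<^bsub>A\<^esub> f = Id A (Dom A f) \<and> f \<cdot>\<^bsub>A\<^esub> g = Id A (Cod A f))"

record ('o, 'a, 'p, 'b) func =
  omap :: "'o \<Rightarrow> 'p"
  amap :: "'a \<Rightarrow> 'b"

locale cat_functor = A: category A + B: category B
  for A :: "('o, 'a) cat" and B :: "('p, 'b) cat" +
  fixes F :: "('o, 'a, 'p, 'b) func"
  assumes omap_obj: "X \<in> Obj A \<Longrightarrow> omap F X \<in> Obj B"
    and amap_hom: "f \<in> hom A X Y \<Longrightarrow> amap F f \<in> hom B (omap F X) (omap F Y)"
    and amap_id: "X \<in> Obj A \<Longrightarrow> amap F (Id A X) = Id B (omap F X)"
    and amap_comp: "f \<in> hom A X Y \<Longrightarrow> g \<in> hom A Y Z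
      \<Longrightarrow> amap F (g \<cdot>\<^bsub>A\<^esub> f) = amap F g \<cdot>\<^bsub>B\<^esub> amap F f"

definition idF :: "('o, 'a, 'o, 'a) func" where
  "idF = \<lparr>omap = (\<lambda>X. X), amap = (\<lambda>f. f)\<rparr>"

definition compF ::
    "('p, 'b, 'q, 'c) func \<Rightarrow> ('o, 'a, 'p, 'b) func \<Rightarrow> ('o, 'a, 'q, 'c) func"
    (infixr "\<circ>\<^sub>F" 75) where
  "G \<circ>\<^sub>F F = \<lparr>omap = (\<lambda>X. omap G (omap F X)), amap = (\<lambda>f. amap G (amap F f))\<rparr>"

text \<open>A transformation is given by its components; only those at objects of the source
  category are meaningful.\<close>

locale nat_trans = F: cat_functor A B F + G: cat_functor A B G
  for A :: "('o, 'a) cat" and B :: "('p, 'b) cat"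
    and F G :: "('o, 'a, 'p, 'b) func" +
  fixes t :: "'o \<Rightarrow> 'b"
  assumes component: "X \<in> Obj A \<Longrightarrow> t X \<in> hom B (omap F X) (omap G X)"
    and naturality: "f \<in> hom A X Y \<Longrightarrow> t Y \<cdot>\<^bsub>B\<^esub> amap F f = amap G f \<cdot>\<^bsub>B\<^esub> t X"

definition invertible_trans ::
    "('o, 'a) cat \<Rightarrow> ('p, 'b) cat \<Rightarrow> ('o, 'a, 'p, 'b) func \<Rightarrow> ('o, 'a, 'p, 'b) func
      \<Rightarrow> ('o \<Rightarrow> 'b) \<Rightarrow> bool" where
  "invertible_trans A B F G t \<longleftrightarrow> nat_trans A B F G t \<and>
     (\<exists>s. nat_trans A B G F s \<and>
        (\<forall>X \<in> Obj A. s X \<cdot>\<^bsub>B\<^esub> t X = Id B (omap F X) \<and> t X \<cdot>\<^bsub>B\<^esub> s X = Id B (omap G X)))"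

section \<open>Adjunctions and adjoint equivalences\<close>

locale adjunction =
  F: cat_functor A B F + G: cat_functor B A G +
  unit: nat_trans A A idF "G \<circ>\<^sub>F F" \<eta> + counit: nat_trans B B "F \<circ>\<^sub>F G" idF \<xi>
  for A :: "('o, 'a) cat" and B :: "('p, 'b) cat"
    and F :: "('o, 'a, 'p, 'b) func" and G :: "('p, 'b, 'o, 'a) func"
    and \<eta> :: "'o \<Rightarrow> 'a" and \<xi> :: "'p \<Rightarrow> 'b" +
  assumes triangle_left: "X \<in> Obj A
      \<Longrightarrow> \<xi> (omap F X) \<cdot>\<^bsub>B\<^esub> amap F (\<eta> X) = Id B (omap F X)"
    and triangle_right: "Y \<in> Obj B
      \<Longrightarrow> amap G (\<xi> Y) \<cdot>\<^bsub>A\<^esub> \<eta> (omap G Y) = Id A (omap G Y)"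

definition adjoint_equivalence ::
    "('o, 'a) cat \<Rightarrow> ('p, 'b) cat \<Rightarrow> ('o, 'a, 'p, 'b) func \<Rightarrow> ('p, 'b, 'o, 'a) func
      \<Rightarrow> ('o \<Rightarrow> 'a) \<Rightarrow> ('p \<Rightarrow> 'b) \<Rightarrow> bool" where
  "adjoint_equivalence A B F G \<eta> \<xi> \<longleftrightarrow> adjunction A B F G \<eta> \<xi> \<and>
     invertible_trans A A idF (G \<circ>\<^sub>F F) \<eta> \<and> invertible_trans B B (F \<circ>\<^sub>F G) idF \<xi>"

definition conservative ::
    "('o, 'a) cat \<Rightarrow> ('p, 'b) cat \<Rightarrow> ('o, 'a, 'p, 'b) func \<Rightarrow> bool" where
  "conservative A B F \<longleftrightarrow> (\<forall>f \<in> Arr A. iso B (amap F f) \<longrightarrow> iso A f)"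

section \<open>Parallel pairs and equalizers\<close>

definition parallel :: "('o, 'a) cat \<Rightarrow> 'a \<Rightarrow> 'a \<Rightarrow> bool" where
  "parallel A f g \<longleftrightarrow> f \<in> Arr A \<and> g \<in> Arr A \<and> Dom A f = Dom A g \<and> Cod A f = Cod A g"

definition coreflexive :: "('o, 'a) cat \<Rightarrow> 'a \<Rightarrow> 'a \<Rightarrow> bool" where
  "coreflexive A f g \<longleftrightarrow> parallel A f g \<and>
     (\<exists>r \<in> hom A (Cod A f) (Dom A f).
        r \<cdot>\<^bsub>A\<^esub> f = Id A (Dom A f) \<and> r \<cdot>\<^bsub>A\<^esub> g = Id A (Dom A f))"

definition split_cofork :: "('o, 'a) cat \<Rightarrow> 'a \<Rightarrow> 'a \<Rightarrow> 'a \<Rightarrow> bool" where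
  "split_cofork A e f g \<longleftrightarrow> parallel A f g \<and>
     e \<in> Arr A \<and> Cod A e = Dom A f \<and> f \<cdot>\<^bsub>A\<^esub> e = g \<cdot>\<^bsub>A\<^esub> e \<and>
     (\<exists>p \<in> hom A (Dom A f) (Dom A e). \<exists>q \<in> hom A (Cod A f) (Dom A f).
        p \<cdot>\<^bsub>A\<^esub> e = Id A (Dom A e) \<and> q \<cdot>\<^bsub>A\<^esub> f = Id A (Dom A f) \<and> e \<cdot>\<^bsub>A\<^esub> p = q \<cdot>\<^bsub>A\<^esub> g)"

definition split_by ::
    "('o, 'a) cat \<Rightarrow> ('p, 'b) cat \<Rightarrow> ('o, 'a, 'p, 'b) func \<Rightarrow> 'a \<Rightarrow> 'a \<Rightarrow> bool" where
  "split_by A B F f g \<longleftrightarrow> parallel A f g \<and>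
     (\<exists>e. split_cofork B e (amap F f) (amap F g))"

definition is_equalizer :: "('o, 'a) cat \<Rightarrow> 'a \<Rightarrow> 'a \<Rightarrow> 'a \<Rightarrow> bool" where
  "is_equalizer A e f g \<longleftrightarrow> parallel A f g \<and>
     e \<in> Arr A \<and> Cod A e = Dom A f \<and> f \<cdot>\<^bsub>A\<^esub> e = g \<cdot>\<^bsub>A\<^esub> e \<and>
     (\<forall>h \<in> Arr A. Cod A h = Dom A f \<and> f \<cdot>\<^bsub>A\<^esub> h = g \<cdot>\<^bsub>A\<^esub> h
        \<longrightarrow> (\<exists>!k. k \<in> hom A (Dom A h) (Dom A e) \<and> e \<cdot>\<^bsub>A\<^esub> k = h))"

definition preserves_equalizer ::
    "('o, 'a) cat \<Rightarrow> ('p, 'b) cat \<Rightarrow> ('o, 'a, 'p, 'b) func \<Rightarrow> 'a \<Rightarrow> 'a \<Rightarrow> bool" where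
  "preserves_equalizer A B F f g \<longleftrightarrow>
     (\<forall>e. is_equalizer A e f g \<longrightarrow> is_equalizer B (amap F e) (amap F f) (amap F g))"

section \<open>Comonads and their coalgebras\<close>

record ('o, 'a) comonad_data =
  fn :: "('o, 'a, 'o, 'a) func"
  comult :: "'o \<Rightarrow> 'a"  ("\<delta>\<index>")
  counit :: "'o \<Rightarrow> 'a"  ("\<epsilon>\<index>")

locale comonad =
  F: cat_functor A A "fn C" +
  comult: nat_trans A A "fn C" "fn C \<circ>\<^sub>F fn C" "\<delta>\<^bsub>C\<^esub>" +
  counit: nat_trans A A "fn C" idF "\<epsilon>\<^bsub>C\<^esub>"
  for A :: "('o, 'a) cat" and C :: "('o, 'a) comonad_data" +
  assumes coassoc: "X \<in> Obj A
      \<Longrightarrow> \<delta>\<^bsub>C\<^esub> (omap (fn C) X) \<cdot>\<^bsub>A\<^esub> \<delta>\<^bsub>C\<^esub> X = amap (fn C) (\<delta>\<^bsub>C\<^esub> X) \<cdot>\<^bsub>A\<^esub> \<delta>\<^bsub>C\<^esub> X"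
    and counit_left: "X \<in> Obj A
      \<Longrightarrow> \<epsilon>\<^bsub>C\<^esub> (omap (fn C) X) \<cdot>\<^bsub>A\<^esub> \<delta>\<^bsub>C\<^esub> X = Id A (omap (fn C) X)"
    and counit_right: "X \<in> Obj A
      \<Longrightarrow> amap (fn C) (\<epsilon>\<^bsub>C\<^esub> X) \<cdot>\<^bsub>A\<^esub> \<delta>\<^bsub>C\<^esub> X = Id A (omap (fn C) X)"

type_synonym ('o, 'a) coalg = "'o \<times> 'a"

text \<open>A morphism of coalgebras records its source and target coalgebras, so that the
  domain and codomain are functions of the arrow.\<close>

type_synonym ('o, 'a) coalg_mor = "('o, 'a) coalg \<times> 'a \<times> ('o, 'a) coalg"

abbreviation und :: "('o, 'a) coalg_mor \<Rightarrow> 'a" where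
  "und f \<equiv> fst (snd f)"

definition coalgebras :: "('o, 'a) cat \<Rightarrow> ('o, 'a) comonad_data \<Rightarrow> ('o, 'a) coalg set" where
  "coalgebras A C = {(X, c). X \<in> Obj A \<and> c \<in> hom A X (omap (fn C) X) \<and>
     \<delta>\<^bsub>C\<^esub> X \<cdot>\<^bsub>A\<^esub> c = amap (fn C) c \<cdot>\<^bsub>A\<^esub> c \<and> \<epsilon>\<^bsub>C\<^esub> X \<cdot>\<^bsub>A\<^esub> c = Id A X}"

definition coalg_cat ::
    "('o, 'a) cat \<Rightarrow> ('o, 'a) comonad_data \<Rightarrow> (('o, 'a) coalg, ('o, 'a) coalg_mor) cat" where
  "coalg_cat A C = \<lparr>
     Obj = coalgebras A C,
     Arr = {(x, f, y). x \<in> coalgebras A C \<and> y \<in> coalgebras A C \<and> f \<in> hom A (fst x) (fst y) \<and>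
              snd y \<cdot>\<^bsub>A\<^esub> f = amap (fn C) f \<cdot>\<^bsub>A\<^esub> snd x},
     Dom = (\<lambda>(x, f, y). x),
     Cod = (\<lambda>(x, f, y). y),
     Id = (\<lambda>x. (x, Id A (fst x), x)),
     Comp = (\<lambda>(y', g, z) (x, f, y). (x, g \<cdot>\<^bsub>A\<^esub> f, z))\<rparr>"

definition cofree :: "('o, 'a) comonad_data \<Rightarrow> 'o \<Rightarrow> ('o, 'a) coalg" where
  "cofree C X = (omap (fn C) X, \<delta>\<^bsub>C\<^esub> X)"

section \<open>Colax morphisms of comonads\<close>

locale colax_comonad_morphism =
  C: comonad A C + D: comonad B D +
  nat_trans A B "H \<circ>\<^sub>F fn C" "fn D \<circ>\<^sub>F H" \<sigma>
  for A :: "('o, 'a) cat" and C :: "('o, 'a) comonad_data"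
    and B :: "('p, 'b) cat" and D :: "('p, 'b) comonad_data"
    and H :: "('o, 'a, 'p, 'b) func" and \<sigma> :: "'o \<Rightarrow> 'b" +
  assumes functor_H: "cat_functor A B H"
    and colax_comult: "X \<in> Obj A \<Longrightarrow> \<delta>\<^bsub>D\<^esub> (omap H X) \<cdot>\<^bsub>B\<^esub> \<sigma> X =
        amap (fn D) (\<sigma> X) \<cdot>\<^bsub>B\<^esub> \<sigma> (omap (fn C) X) \<cdot>\<^bsub>B\<^esub> amap H (\<delta>\<^bsub>C\<^esub> X)"
    and colax_counit: "X \<in> Obj A
      \<Longrightarrow> \<epsilon>\<^bsub>D\<^esub> (omap H X) \<cdot>\<^bsub>B\<^esub> \<sigma> X = amap H (\<epsilon>\<^bsub>C\<^esub> X)"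

definition mate ::
    "('o, 'a) cat \<Rightarrow> ('o, 'a) comonad_data \<Rightarrow> ('p, 'b) comonad_data
      \<Rightarrow> ('p, 'b, 'o, 'a) func \<Rightarrow> ('o \<Rightarrow> 'a) \<Rightarrow> ('p \<Rightarrow> 'b) \<Rightarrow> ('o \<Rightarrow> 'b) \<Rightarrow> 'p \<Rightarrow> 'a" where
  "mate A C D K \<eta> \<xi> \<sigma> = (\<lambda>N.
     amap K (amap (fn D) (\<xi> N)) \<cdot>\<^bsub>A\<^esub> amap K (\<sigma> (omap K N)) \<cdot>\<^bsub>A\<^esub> \<eta> (omap (fn C) (omap K N)))"

definition conjugate_comonad ::
    "('p, 'b) cat \<Rightarrow> ('o, 'a) comonad_data \<Rightarrow> ('o, 'a, 'p, 'b) func \<Rightarrow> ('p, 'b, 'o, 'a) func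
      \<Rightarrow> ('o \<Rightarrow> 'a) \<Rightarrow> ('p \<Rightarrow> 'b) \<Rightarrow> ('p, 'b) comonad_data" where
  "conjugate_comonad B C H K \<eta> \<xi> = \<lparr>
     fn = H \<circ>\<^sub>F fn C \<circ>\<^sub>F K,
     comult = (\<lambda>N. amap H (amap (fn C) (\<eta> (omap (fn C) (omap K N)))) \<cdot>\<^bsub>B\<^esub> amap H (\<delta>\<^bsub>C\<^esub> (omap K N))),
     counit = (\<lambda>N. \<xi> N \<cdot>\<^bsub>B\<^esub> amap H (\<epsilon>\<^bsub>C\<^esub> (omap K N)))\<rparr>"

text \<open>The transformation \<open>\<sigma>' = (D \<xi>) \<circ> (\<sigma> K)\<close>; lemma \<open>conjugate_trans_universal\<close> below shows
  that it is the one given by the universal property of the conjugate comonad.\<close>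

definition conjugate_trans ::
    "('p, 'b) cat \<Rightarrow> ('p, 'b) comonad_data \<Rightarrow> ('p, 'b, 'o, 'a) func
      \<Rightarrow> ('p \<Rightarrow> 'b) \<Rightarrow> ('o \<Rightarrow> 'b) \<Rightarrow> 'p \<Rightarrow> 'b" where
  "conjugate_trans B D K \<xi> \<sigma> = (\<lambda>N. amap (fn D) (\<xi> N) \<cdot>\<^bsub>B\<^esub> \<sigma> (omap K N))"

lemma conjugate_trans_universal:
  assumes adj: "adjunction A B H K \<eta> \<xi>"
    and C: "cat_functor A A (fn C)" and D: "cat_functor B B (fn D)"
    and s: "nat_trans A B (H \<circ>\<^sub>F fn C) (fn D \<circ>\<^sub>F H) \<sigma>"
  shows "nat_trans B B (fn (conjugate_comonad B C H K \<eta> \<xi>)) (fn D) (conjugate_trans B D K \<xi> \<sigma>)"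
    and "X \<in> Obj A \<Longrightarrow>
      conjugate_trans B D K \<xi> \<sigma> (omap H X) \<cdot>\<^bsub>B\<^esub> amap H (amap (fn C) (\<eta> X)) = \<sigma> X"
    and "\<lbrakk>nat_trans B B (fn (conjugate_comonad B C H K \<eta> \<xi>)) (fn D) t;
      \<And>X. X \<in> Obj A \<Longrightarrow> t (omap H X) \<cdot>\<^bsub>B\<^esub> amap H (amap (fn C) (\<eta> X)) = \<sigma> X; N \<in> Obj B\<rbrakk>
      \<Longrightarrow> t N = conjugate_trans B D K \<xi> \<sigma> N"
proof -
  interpret adj: adjunction A B H K \<eta> \<xi> by (rule adj)
  interpret C: cat_functor A A "fn C" by (rule C)
  interpret D: cat_functor B B "fn D" by (rule D)
  interpret s: nat_trans A B "H \<circ>\<^sub>F fn C" "fn D \<circ>\<^sub>F H" \<sigma> by (rule s)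
  have eta: "\<eta> X \<in> hom A X (omap K (omap H X))" if "X \<in> Obj A" for X
    using adj.unit.component[OF that] by (simp add: idF_def compF_def)
  have xi: "\<xi> N \<in> hom B (omap H (omap K N)) N" if "N \<in> Obj B" for N
    using adj.counit.component[OF that] by (simp add: idF_def compF_def)
  have xi_nat: "\<xi> Z \<cdot>\<^bsub>B\<^esub> amap H (amap K f) = f \<cdot>\<^bsub>B\<^esub> \<xi> Y" if "f \<in> hom B Y Z" for f Y Z
    using adj.counit.naturality[OF that] by (simp add: idF_def compF_def)
  have sg: "\<sigma> X \<in> hom B (omap H (omap (fn C) X)) (omap (fn D) (omap H X))" if "X \<in> Obj A" for X
    using s.component[OF that] by (simp add: compF_def)
  have sg_nat: "\<sigma> Y \<cdot>\<^bsub>B\<^esub> amap H (amap (fn C) f) = amap (fn D) (amap H f) \<cdot>\<^bsub>B\<^esub> \<sigma> X"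
    if "f \<in> hom A X Y" for f X Y
    using s.naturality[OF that] by (simp add: compF_def)
  have hom_obj: "f \<in> hom B X Y \<Longrightarrow> X \<in> Obj B \<and> Y \<in> Obj B" for f X Y
    using adj.F.B.dom_obj adj.F.B.cod_obj by (auto simp: hom_def)
  note KO = adj.G.omap_obj and HO = adj.F.omap_obj and CO = C.omap_obj
    and KH = adj.G.amap_hom and HH = adj.F.amap_hom and CH = C.amap_hom and DH = D.amap_hom
  let ?s = "conjugate_trans B D K \<xi> \<sigma>"
  let ?F = "fn (conjugate_comonad B C H K \<eta> \<xi>)"
  have F_functor: "cat_functor B B ?F"
  proof unfold_locales
    fix X assume "X \<in> Obj B"
    then show "omap ?F X \<in> Obj B" "amap ?F (Id B X) = Id B (omap ?F X)"
      by (simp_all add: conjugate_comonad_def compF_def KO CO HO adj.G.amap_id C.amap_id adj.F.amap_id)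
  next
    fix f X Y assume "f \<in> hom B X Y"
    then show "amap ?F f \<in> hom B (omap ?F X) (omap ?F Y)"
      by (simp add: conjugate_comonad_def compF_def KH CH HH)
  next
    fix f g X Y Z assume f: "f \<in> hom B X Y" and g: "g \<in> hom B Y Z"
    show "amap ?F (g \<cdot>\<^bsub>B\<^esub> f) = amap ?F g \<cdot>\<^bsub>B\<^esub> amap ?F f"
      using adj.G.amap_comp[OF f g] C.amap_comp[OF KH[OF f] KH[OF g]]
        adj.F.amap_comp[OF CH[OF KH[OF f]] CH[OF KH[OF g]]]
      by (simp add: conjugate_comonad_def compF_def)
  qed
  have s_hom: "?s Y \<in> hom B (omap H (omap (fn C) (omap K Y))) (omap (fn D) Y)" if "Y \<in> Obj B" for Y
    unfolding conjugate_trans_def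
    by (rule adj.F.B.comp_hom[OF sg[OF KO[OF that]] DH[OF xi[OF that]]])
  show "nat_trans B B ?F (fn D) ?s"
  proof (intro nat_trans.intro nat_trans_axioms.intro F_functor D)
    fix X assume "X \<in> Obj B"
    then show "?s X \<in> hom B (omap ?F X) (omap (fn D) X)"
      using s_hom by (simp add: conjugate_comonad_def compF_def)
  next
    fix f X Y assume f: "f \<in> hom B X Y"
    then have X: "X \<in> Obj B" and Y: "Y \<in> Obj B" using hom_obj by auto
    have "?s Y \<cdot>\<^bsub>B\<^esub> amap H (amap (fn C) (amap K f))
        = amap (fn D) (\<xi> Y) \<cdot>\<^bsub>B\<^esub> (\<sigma> (omap K Y) \<cdot>\<^bsub>B\<^esub> amap H (amap (fn C) (amap K f)))"
      unfolding conjugate_trans_def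
      by (rule adj.F.B.assoc[OF HH[OF CH[OF KH[OF f]]] sg[OF KO[OF Y]] DH[OF xi[OF Y]]])
    also have "\<dots> = amap (fn D) (\<xi> Y) \<cdot>\<^bsub>B\<^esub> (amap (fn D) (amap H (amap K f)) \<cdot>\<^bsub>B\<^esub> \<sigma> (omap K X))"
      by (simp add: sg_nat[OF KH[OF f]])
    also have "\<dots> = amap (fn D) (\<xi> Y \<cdot>\<^bsub>B\<^esub> amap H (amap K f)) \<cdot>\<^bsub>B\<^esub> \<sigma> (omap K X)"
      by (simp add: adj.F.B.assoc[OF sg[OF KO[OF X]] DH[OF HH[OF KH[OF f]]] DH[OF xi[OF Y]]]
          D.amap_comp[OF HH[OF KH[OF f]] xi[OF Y]])
    also have "\<dots> = amap (fn D) (f \<cdot>\<^bsub>B\<^esub> \<xi> X) \<cdot>\<^bsub>B\<^esub> \<sigma> (omap K X)"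
      by (simp add: xi_nat[OF f])
    also have "\<dots> = amap (fn D) f \<cdot>\<^bsub>B\<^esub> ?s X"
      unfolding conjugate_trans_def
      by (simp add: D.amap_comp[OF xi[OF X] f] adj.F.B.assoc[OF sg[OF KO[OF X]] DH[OF xi[OF X]] DH[OF f]])
    finally show "?s Y \<cdot>\<^bsub>B\<^esub> amap ?F f = amap (fn D) f \<cdot>\<^bsub>B\<^esub> ?s X"
      by (simp add: conjugate_comonad_def compF_def)
  qed
  show "?s (omap H X) \<cdot>\<^bsub>B\<^esub> amap H (amap (fn C) (\<eta> X)) = \<sigma> X" if X: "X \<in> Obj A" for X
  proof -
    note HX = HO[OF X]
    have "?s (omap H X) \<cdot>\<^bsub>B\<^esub> amap H (amap (fn C) (\<eta> X))
        = amap (fn D) (\<xi> (omap H X)) \<cdot>\<^bsub>B\<^esub>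
            (\<sigma> (omap K (omap H X)) \<cdot>\<^bsub>B\<^esub> amap H (amap (fn C) (\<eta> X)))"
      unfolding conjugate_trans_def
      by (rule adj.F.B.assoc[OF HH[OF CH[OF eta[OF X]]] sg[OF KO[OF HX]] DH[OF xi[OF HX]]])
    also have "\<dots> = amap (fn D) (\<xi> (omap H X) \<cdot>\<^bsub>B\<^esub> amap H (\<eta> X)) \<cdot>\<^bsub>B\<^esub> \<sigma> X"
      by (simp add: sg_nat[OF eta[OF X]] D.amap_comp[OF HH[OF eta[OF X]] xi[OF HX]]
          adj.F.B.assoc[OF sg[OF X] DH[OF HH[OF eta[OF X]]] DH[OF xi[OF HX]]])
    also have "\<dots> = \<sigma> X"
      by (simp add: adj.triangle_left[OF X] D.amap_id[OF HX] adj.F.B.id_left[OF sg[OF X]])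
    finally show ?thesis .
  qed
  show "t N = ?s N"
    if t: "nat_trans B B ?F (fn D) t" and N: "N \<in> Obj B"
      and eq: "\<And>X. X \<in> Obj A \<Longrightarrow> t (omap H X) \<cdot>\<^bsub>B\<^esub> amap H (amap (fn C) (\<eta> X)) = \<sigma> X"
    for t N
  proof -
    interpret t: nat_trans B B ?F "fn D" t by (rule t)
    have t_hom: "t Y \<in> hom B (omap H (omap (fn C) (omap K Y))) (omap (fn D) Y)" if "Y \<in> Obj B" for Y
      using t.component[OF that] by (simp add: conjugate_comonad_def compF_def)
    have t_nat: "t N \<cdot>\<^bsub>B\<^esub> amap H (amap (fn C) (amap K (\<xi> N)))
        = amap (fn D) (\<xi> N) \<cdot>\<^bsub>B\<^esub> t (omap H (omap K N))"
      using t.naturality[OF xi[OF N]] by (simp add: conjugate_comonad_def compF_def)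
    note KN = KO[OF N] and HKN = HO[OF KO[OF N]]
    note e = HH[OF CH[OF eta[OF KN]]] and k = HH[OF CH[OF KH[OF xi[OF N]]]]
    have "?s N = amap (fn D) (\<xi> N) \<cdot>\<^bsub>B\<^esub>
        (t (omap H (omap K N)) \<cdot>\<^bsub>B\<^esub> amap H (amap (fn C) (\<eta> (omap K N))))"
      unfolding conjugate_trans_def by (simp add: eq[OF KN])
    also have "\<dots> = (t N \<cdot>\<^bsub>B\<^esub> amap H (amap (fn C) (amap K (\<xi> N)))) \<cdot>\<^bsub>B\<^esub>
        amap H (amap (fn C) (\<eta> (omap K N)))"
      by (simp add: t_nat adj.F.B.assoc[OF e t_hom[OF HKN] DH[OF xi[OF N]]])
    also have "\<dots> = t N \<cdot>\<^bsub>B\<^esub> amap H (amap (fn C) (amap K (\<xi> N) \<cdot>\<^bsub>A\<^esub> \<eta> (omap K N)))"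
      by (simp add: adj.F.B.assoc[OF e k t_hom[OF N]] C.amap_comp[OF eta[OF KN] KH[OF xi[OF N]]]
          adj.F.amap_comp[OF CH[OF eta[OF KN]] CH[OF KH[OF xi[OF N]]]])
    also have "\<dots> = t N"
      by (simp add: adj.triangle_right[OF N] C.amap_id[OF KN] adj.F.amap_id[OF CO[OF KN]]
          adj.F.B.id_right[OF t_hom[OF N]])
    finally show ?thesis by simp
  qed
qed

section \<open>The functors between coalgebra categories\<close>

definition H_sigma_obj ::
    "('p, 'b) cat \<Rightarrow> ('o, 'a, 'p, 'b) func \<Rightarrow> ('o \<Rightarrow> 'b) \<Rightarrow> ('o, 'a) coalg \<Rightarrow> ('p, 'b) coalg" where
  "H_sigma_obj B H \<sigma> = (\<lambda>(X, c). (omap H X, \<sigma> X \<cdot>\<^bsub>B\<^esub> amap H c))"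

definition H_sigma ::
    "('p, 'b) cat \<Rightarrow> ('o, 'a, 'p, 'b) func \<Rightarrow> ('o \<Rightarrow> 'b)
      \<Rightarrow> (('o, 'a) coalg, ('o, 'a) coalg_mor, ('p, 'b) coalg, ('p, 'b) coalg_mor) func" where
  "H_sigma B H \<sigma> = \<lparr>
     omap = H_sigma_obj B H \<sigma>,
     amap = (\<lambda>(x, f, y). (H_sigma_obj B H \<sigma> x, amap H f, H_sigma_obj B H \<sigma> y))\<rparr>"

text \<open>The parallel pair of morphisms of cofree coalgebras
  \<open>C K N \<rightrightarrows> C K D N\<close> attached to a \<open>D\<close>-coalgebra \<open>(N, d)\<close>.\<close>

definition K_tau_left ::
    "('o, 'a) cat \<Rightarrow> ('o, 'a) comonad_data \<Rightarrow> ('p, 'b) comonad_data \<Rightarrow> ('p, 'b, 'o, 'a) func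
      \<Rightarrow> ('p \<Rightarrow> 'a) \<Rightarrow> ('p, 'b) coalg \<Rightarrow> ('o, 'a) coalg_mor" where
  "K_tau_left A C D K \<tau> = (\<lambda>(N, d).
     (cofree C (omap K N),
      amap (fn C) (\<tau> N) \<cdot>\<^bsub>A\<^esub> \<delta>\<^bsub>C\<^esub> (omap K N),
      cofree C (omap K (omap (fn D) N))))"

definition K_tau_right ::
    "('o, 'a) comonad_data \<Rightarrow> ('p, 'b) comonad_data \<Rightarrow> ('p, 'b, 'o, 'a) func
      \<Rightarrow> ('p, 'b) coalg \<Rightarrow> ('o, 'a) coalg_mor" where
  "K_tau_right C D K = (\<lambda>(N, d).
     (cofree C (omap K N),
      amap (fn C) (amap K d),
      cofree C (omap K (omap (fn D) N))))"

definition K_tau_defined ::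
    "('o, 'a) cat \<Rightarrow> ('o, 'a) comonad_data \<Rightarrow> ('p, 'b) cat \<Rightarrow> ('p, 'b) comonad_data
      \<Rightarrow> ('p, 'b, 'o, 'a) func \<Rightarrow> ('p \<Rightarrow> 'a) \<Rightarrow> bool" where
  "K_tau_defined A C B D K \<tau> \<longleftrightarrow> (\<forall>y \<in> coalgebras B D.
     \<exists>e. is_equalizer (coalg_cat A C) e (K_tau_left A C D K \<tau> y) (K_tau_right C D K y))"

text \<open>The functor \<open>K\<^sup>\<tau>\<close> and its adjunction data depend on a choice of equalizers: \<open>e y\<close> is
  the chosen canonical map out of \<open>K\<^sup>\<tau> y\<close>, for each \<open>D\<close>-coalgebra \<open>y\<close>.\<close>

definition equalizer_choice ::
    "('o, 'a) cat \<Rightarrow> ('o, 'a) comonad_data \<Rightarrow> ('p, 'b) cat \<Rightarrow> ('p, 'b) comonad_data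
      \<Rightarrow> ('p, 'b, 'o, 'a) func \<Rightarrow> ('p \<Rightarrow> 'a)
      \<Rightarrow> (('p, 'b) coalg \<Rightarrow> ('o, 'a) coalg_mor) \<Rightarrow> bool" where
  "equalizer_choice A C B D K \<tau> e \<longleftrightarrow> (\<forall>y \<in> coalgebras B D.
     is_equalizer (coalg_cat A C) (e y) (K_tau_left A C D K \<tau> y) (K_tau_right C D K y))"

definition K_tau_obj ::
    "('o, 'a) cat \<Rightarrow> ('o, 'a) comonad_data \<Rightarrow> (('p, 'b) coalg \<Rightarrow> ('o, 'a) coalg_mor)
      \<Rightarrow> ('p, 'b) coalg \<Rightarrow> ('o, 'a) coalg" where
  "K_tau_obj A C e y = Dom (coalg_cat A C) (e y)"

definition K_tau ::
    "('o, 'a) cat \<Rightarrow> ('o, 'a) comonad_data \<Rightarrow> ('p, 'b, 'o, 'a) func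
      \<Rightarrow> (('p, 'b) coalg \<Rightarrow> ('o, 'a) coalg_mor)
      \<Rightarrow> (('p, 'b) coalg, ('p, 'b) coalg_mor, ('o, 'a) coalg, ('o, 'a) coalg_mor) func" where
  "K_tau A C K e = \<lparr>
     omap = K_tau_obj A C e,
     amap = (\<lambda>(y, g, z).
       THE k. k \<in> hom (coalg_cat A C) (K_tau_obj A C e y) (K_tau_obj A C e z) \<and>
         e z \<cdot>\<^bsub>coalg_cat A C\<^esub> k =
         (cofree C (omap K (fst y)), amap (fn C) (amap K g), cofree C (omap K (fst z)))
           \<cdot>\<^bsub>coalg_cat A C\<^esub> e y)\<rparr>"

definition K_tau_unit ::
    "('o, 'a) cat \<Rightarrow> ('o, 'a) comonad_data \<Rightarrow> ('p, 'b) cat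
      \<Rightarrow> ('o, 'a, 'p, 'b) func \<Rightarrow> ('p, 'b, 'o, 'a) func \<Rightarrow> ('o \<Rightarrow> 'a) \<Rightarrow> ('o \<Rightarrow> 'b)
      \<Rightarrow> (('p, 'b) coalg \<Rightarrow> ('o, 'a) coalg_mor) \<Rightarrow> ('o, 'a) coalg \<Rightarrow> ('o, 'a) coalg_mor" where
  "K_tau_unit A C B H K \<eta> \<sigma> e = (\<lambda>(X, c).
     THE k. k \<in> hom (coalg_cat A C) (X, c) (K_tau_obj A C e (H_sigma_obj B H \<sigma> (X, c))) \<and>
       e (H_sigma_obj B H \<sigma> (X, c)) \<cdot>\<^bsub>coalg_cat A C\<^esub> k =
       ((X, c), amap (fn C) (\<eta> X) \<cdot>\<^bsub>A\<^esub> c, cofree C (omap K (omap H X))))"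

definition K_tau_counit ::
    "('o, 'a) cat \<Rightarrow> ('o, 'a) comonad_data \<Rightarrow> ('p, 'b) cat
      \<Rightarrow> ('o, 'a, 'p, 'b) func \<Rightarrow> ('p, 'b, 'o, 'a) func \<Rightarrow> ('p \<Rightarrow> 'b) \<Rightarrow> ('o \<Rightarrow> 'b)
      \<Rightarrow> (('p, 'b) coalg \<Rightarrow> ('o, 'a) coalg_mor) \<Rightarrow> ('p, 'b) coalg \<Rightarrow> ('p, 'b) coalg_mor" where
  "K_tau_counit A C B H K \<xi> \<sigma> e = (\<lambda>(N, d).
     (H_sigma_obj B H \<sigma> (K_tau_obj A C e (N, d)),
      \<xi> N \<cdot>\<^bsub>B\<^esub> amap H (\<epsilon>\<^bsub>C\<^esub> (omap K N)) \<cdot>\<^bsub>B\<^esub> amap H (und (e (N, d))),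
      (N, d)))"

end

theory Submission
  imports Defs
begin

text \<open>Composing the forgetful functor of the category of \<open>C\<close>-coalgebras with \<open>H\<close> gives a functor
  to \<open>N\<close> whose right adjoint sends \<open>Y\<close> to the cofree coalgebra on \<open>K Y\<close>. Under this composite
  adjunction a morphism \<open>k\<close> from a coalgebra \<open>(X, c)\<close> to the cofree coalgebra on \<open>K Y\<close>
  corresponds to an arrow \<open>f : H X \<rightarrow> Y\<close>, its adjunct. The argument rests on one computation: for
  a \<open>D\<close>-coalgebra \<open>(Y, d)\<close>, the composites of \<open>k\<close> with the two arrows that define \<open>K\<^sup>\<tau> (Y, d)\<close>
  have the adjuncts \<open>D f \<circ> \<sigma>\<^sub>X \<circ> H c\<close> and \<open>d \<circ> f\<close> (\<open>adjunct_left\<close>, \<open>adjunct_right\<close>). So \<open>k\<close>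
  equalizes the pair exactly when \<open>f\<close> is a morphism of \<open>D\<close>-coalgebras from \<open>H\<^sub>\<sigma> (X, c)\<close> to
  \<open>(Y, d)\<close> (\<open>equalizes_iff_coalg_arr\<close>). An equalizer of the pair is therefore the same thing as
  a universal arrow from \<open>H\<^sub>\<sigma>\<close> to \<open>(Y, d)\<close>, namely the adjunct of the canonical map, and the
  adjunction between \<open>H\<^sub>\<sigma>\<close> and \<open>K\<^sup>\<tau>\<close> follows formally (\<open>K_tau_adjunction\<close>).

  Suppose that this adjunction is an equivalence. For each \<open>Y\<close> the arrow \<open>\<sigma>'\<^sub>Y\<close> is itself a
  universal arrow from \<open>H\<^sub>\<sigma>\<close> to the cofree \<open>D\<close>-coalgebra on \<open>Y\<close>, starting at the cofree
  \<open>C\<close>-coalgebra on \<open>K Y\<close> (\<open>conj_universal_arrow\<close>): morphisms into a cofree \<open>D\<close>-coalgebra are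
  determined by their composites with \<open>\<epsilon>\<^sub>Y\<close>, and \<open>\<epsilon>\<^sub>Y \<circ> \<sigma>'\<^sub>Y = \<xi>\<^sub>Y \<circ> H \<epsilon>\<close> is the counit of the
  composite adjunction. Universal arrows are unique up to isomorphism, so \<open>\<sigma>'\<^sub>Y\<close> is invertible
  because the counit at the cofree coalgebra is.

  Suppose conversely that \<open>\<sigma>'\<close> is invertible. It carries the \<open>H\<close>-image of the pair attached to
  \<open>(Y, d)\<close> to the pair \<open>\<delta>\<^sub>Y, D d\<close>, which is split by \<open>d\<close> (\<open>pair_split_cofork\<close>), and the
  pair is coreflexive with retraction \<open>C K \<epsilon>\<close> (\<open>pair_coreflexive\<close>). So it has an equalizer in
  \<open>M\<close>. As \<open>C\<close> and \<open>C\<^sup>2\<close> preserve it, this equalizer lifts to coalgebras, and every equalizer of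
  coalgebras lies over an equalizer in \<open>M\<close> (\<open>coalg_equalizer_lift\<close>, \<open>coalg_equalizer_und\<close>). Since
  \<open>H\<close> preserves it too, the image of the canonical map and the inverse of \<open>\<sigma>'\<^sub>Y\<close> composed with
  \<open>d\<close> are both equalizers of the same pair; the comparison between them is the counit, which is
  thus invertible (\<open>counit_iso_of_equalizer\<close>). A triangle identity then shows that \<open>H\<close> inverts the
  unit, so the unit is invertible because \<open>H\<close> is conservative (\<open>unit_iso\<close>).\<close>

section \<open>Arrows, isomorphisms and equalizers in a category\<close>

lemma hom_iff: "f \<in> hom A X Y \<longleftrightarrow> f \<in> Arr A \<and> Dom A f = X \<and> Cod A f = Y"
  by (simp add: hom_def)

lemma omap_idF [simp]: "omap idF X = X"
  and amap_idF [simp]: "amap idF f = f"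
  and omap_compF [simp]: "omap (G \<circ>\<^sub>F F) X = omap G (omap F X)"
  and amap_compF [simp]: "amap (G \<circ>\<^sub>F F) f = amap G (amap F f)"
  by (simp_all add: idF_def compF_def)

context category
begin

declare dom_obj [simp] cod_obj [simp]

lemma Id_arr [simp]:
  assumes "X \<in> Obj A"
  shows "Id A X \<in> Arr A" "Dom A (Id A X) = X" "Cod A (Id A X) = X"
  using id_hom[OF assms] by (auto simp: hom_iff)

lemma comp_arr [simp]:
  assumes "f \<in> Arr A" "g \<in> Arr A" "Cod A f = Dom A g"
  shows "g \<cdot> f \<in> Arr A" "Dom A (g \<cdot> f) = Dom A f" "Cod A (g \<cdot> f) = Cod A g"
  using comp_hom[of f "Dom A f" "Dom A g" g "Cod A g"] assms by (auto simp: hom_iff)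

lemma Id_comp [simp]:
  assumes "f \<in> Arr A" "Cod A f = Y"
  shows "Id A Y \<cdot> f = f"
  using id_left[of f "Dom A f" Y] assms by (simp add: hom_iff)

lemma comp_Id [simp]:
  assumes "f \<in> Arr A" "Dom A f = X"
  shows "f \<cdot> Id A X = f"
  using id_right[of f X "Cod A f"] assms by (simp add: hom_iff)

lemma comp_assoc [simp]:
  assumes "f \<in> Arr A" "g \<in> Arr A" "h \<in> Arr A" "Cod A f = Dom A g" "Cod A g = Dom A h"
  shows "(h \<cdot> g) \<cdot> f = h \<cdot> (g \<cdot> f)"
  using assoc[of f "Dom A f" "Cod A f" g "Cod A g" h "Cod A h"] assms by (simp add: hom_iff)

text \<open>Composites are normalised to the right, so an equation between two arrows can be applied
  inside a longer composite only in this extended form.\<close>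

lemma comp_eq_extend:
  assumes "g \<cdot> f = u"
    and "f \<in> Arr A" "g \<in> Arr A" "h \<in> Arr A" "Cod A f = Dom A g" "Cod A h = Dom A f"
  shows "g \<cdot> (f \<cdot> h) = u \<cdot> h"
  using assms(1) comp_assoc[of h f g] assms by simp

lemma isoI:
  assumes "f \<in> Arr A" "g \<in> Arr A" "Dom A g = Cod A f" "Cod A g = Dom A f"
    and "g \<cdot> f = Id A (Dom A f)" "f \<cdot> g = Id A (Cod A f)"
  shows "iso A f"
  using assms by (auto simp: iso_def hom_iff)

lemma isoE:
  assumes "iso A f"
  obtains g where "f \<in> Arr A" "g \<in> Arr A" "Dom A g = Cod A f" "Cod A g = Dom A f"
    "g \<cdot> f = Id A (Dom A f)" "f \<cdot> g = Id A (Cod A f)"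
  using assms by (auto simp: iso_def hom_iff)

lemma iso_comp:
  assumes "iso A f" "iso A g" "Cod A f = Dom A g"
  shows "iso A (g \<cdot> f)"
proof -
  from assms obtain f' g' where
    f: "f \<in> Arr A" "f' \<in> Arr A" "Dom A f' = Cod A f" "Cod A f' = Dom A f"
      "f' \<cdot> f = Id A (Dom A f)" "f \<cdot> f' = Id A (Cod A f)"
    and g: "g \<in> Arr A" "g' \<in> Arr A" "Dom A g' = Cod A g" "Cod A g' = Dom A g"
      "g' \<cdot> g = Id A (Dom A g)" "g \<cdot> g' = Id A (Cod A g)"
    by (metis isoE)
  show ?thesis
    by (rule isoI[of _ "f' \<cdot> g'"])
      (use f g assms(3) comp_eq_extend[OF g(5)] comp_eq_extend[OF f(6)] in simp_all)
qed

text \<open>The arrow \<open>f\<close> has to coincide with the two-sided inverse of \<open>g\<close>.\<close>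

lemma iso_section:
  assumes "iso A g" "f \<in> Arr A" "Cod A f = Dom A g" "g \<cdot> f = Id A (Cod A g)"
  shows "iso A f"
proof -
  from assms(1) obtain g' where
    g: "g \<in> Arr A" "g' \<in> Arr A" "Dom A g' = Cod A g" "Cod A g' = Dom A g"
      "g' \<cdot> g = Id A (Dom A g)" "g \<cdot> g' = Id A (Cod A g)"
    by (metis isoE)
  have dom: "Dom A f = Cod A g"
    using comp_arr(2)[of f g] assms g by simp
  have "f = g' \<cdot> (g \<cdot> f)"
    using assms(2,3) g comp_eq_extend[OF g(5)] by simp
  then have "f = g'"
    using g dom by (simp add: assms(4))
  then show ?thesis
    using g by (auto intro: isoI[of g' g])
qed

lemma equalizerD:
  assumes "is_equalizer A e f g"
  shows "f \<in> Arr A" "g \<in> Arr A" "Dom A g = Dom A f" "Cod A g = Cod A f"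
    "e \<in> Arr A" "Cod A e = Dom A f" "f \<cdot> e = g \<cdot> e"
  using assms by (auto simp: is_equalizer_def parallel_def)

lemma equalizer_ex1:
  assumes "is_equalizer A e f g"
    and "h \<in> Arr A" "Cod A h = Dom A f" "f \<cdot> h = g \<cdot> h"
  shows "\<exists>!k. k \<in> hom A (Dom A h) (Dom A e) \<and> e \<cdot> k = h"
proof -
  have "\<forall>h \<in> Arr A. Cod A h = Dom A f \<and> f \<cdot> h = g \<cdot> h
      \<longrightarrow> (\<exists>!k. k \<in> hom A (Dom A h) (Dom A e) \<and> e \<cdot> k = h)"
    using assms(1) by (simp add: is_equalizer_def)
  from this[rule_format, OF assms(2) conjI[OF assms(3,4)]] show ?thesis .
qed

lemma equalizer_factor:
  assumes "is_equalizer A e f g"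
    and "h \<in> Arr A" "Cod A h = Dom A f" "f \<cdot> h = g \<cdot> h"
  obtains k where "k \<in> Arr A" "Dom A k = Dom A h" "Cod A k = Dom A e" "e \<cdot> k = h"
proof -
  from ex1_implies_ex[OF equalizer_ex1[OF assms]]
  show thesis
    by (auto simp: hom_iff intro: that)
qed

lemma equalizer_mono:
  assumes eq: "is_equalizer A e f g"
    and k: "k \<in> Arr A" "Cod A k = Dom A e"
    and k': "k' \<in> Arr A" "Cod A k' = Dom A e" "Dom A k = Dom A k'"
    and same: "e \<cdot> k = e \<cdot> k'"
  shows "k = k'"
proof -
  note e = equalizerD[OF eq]
  have "f \<cdot> (e \<cdot> k') = g \<cdot> (e \<cdot> k')"
    using comp_eq_extend[OF e(7)] e k' by simp
  then have "\<exists>!j. j \<in> hom A (Dom A (e \<cdot> k')) (Dom A e) \<and> e \<cdot> j = e \<cdot> k'"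
    using e k' by (intro equalizer_ex1[OF eq]) simp_all
  then show ?thesis
    using e k k' same by (auto simp: hom_iff)
qed

lemma equalizerI:
  assumes "f \<in> Arr A" "g \<in> Arr A" "Dom A g = Dom A f" "Cod A g = Cod A f"
    "e \<in> Arr A" "Cod A e = Dom A f" "f \<cdot> e = g \<cdot> e"
    and factor: "\<And>h. h \<in> Arr A \<Longrightarrow> Cod A h = Dom A f \<Longrightarrow> f \<cdot> h = g \<cdot> h
      \<Longrightarrow> \<exists>k. k \<in> Arr A \<and> Dom A k = Dom A h \<and> Cod A k = Dom A e \<and> e \<cdot> k = h"
    and mono: "\<And>k k'. k \<in> Arr A \<Longrightarrow> k' \<in> Arr A \<Longrightarrow> Dom A k' = Dom A k
      \<Longrightarrow> Cod A k = Dom A e \<Longrightarrow> Cod A k' = Dom A e \<Longrightarrow> e \<cdot> k = e \<cdot> k' \<Longrightarrow> k = k'"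
  shows "is_equalizer A e f g"
  unfolding is_equalizer_def parallel_def
proof (intro conjI ballI impI)
  fix h assume "h \<in> Arr A" "Cod A h = Dom A f \<and> f \<cdot> h = g \<cdot> h"
  then obtain k where "k \<in> hom A (Dom A h) (Dom A e)" "e \<cdot> k = h"
    using factor[of h] by (auto simp: hom_iff)
  then show "\<exists>!k. k \<in> hom A (Dom A h) (Dom A e) \<and> e \<cdot> k = h"
    by (intro ex1I[of _ k]) (auto simp: hom_iff intro: mono)
qed (use assms in auto)

lemma equalizers_iso:
  assumes e: "is_equalizer A e f g" and e': "is_equalizer A e' f g"
  obtains u where "iso A u" "Dom A u = Dom A e'" "Cod A u = Dom A e" "e \<cdot> u = e'"
proof -
  note d = equalizerD[OF e] and d' = equalizerD[OF e']
  obtain u where u: "u \<in> Arr A" "Dom A u = Dom A e'" "Cod A u = Dom A e" "e \<cdot> u = e'"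
    using equalizer_factor[OF e, of e'] d d' by metis
  obtain v where v: "v \<in> Arr A" "Dom A v = Dom A e" "Cod A v = Dom A e'" "e' \<cdot> v = e"
    using equalizer_factor[OF e', of e] d d' by metis
  have "u \<cdot> v = Id A (Dom A e)"
    by (rule equalizer_mono[OF e]) (use d d' u v comp_eq_extend[OF u(4)] in simp_all)
  moreover have "v \<cdot> u = Id A (Dom A e')"
    by (rule equalizer_mono[OF e']) (use d d' u v comp_eq_extend[OF v(4)] in simp_all)
  ultimately have "iso A u"
    using u v by (auto intro: isoI[of u v])
  then show thesis
    using that u by blast
qed

lemma equalizer_precomp_iso:
  assumes e: "is_equalizer A e f g" and u: "iso A u" "Cod A u = Dom A e"
  shows "is_equalizer A (e \<cdot> u) f g"
proof -
  note d = equalizerD[OF e]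
  from u(1) obtain v where
    v: "u \<in> Arr A" "v \<in> Arr A" "Dom A v = Cod A u" "Cod A v = Dom A u"
      "v \<cdot> u = Id A (Dom A u)" "u \<cdot> v = Id A (Cod A u)"
    by (metis isoE)
  show ?thesis
  proof (rule equalizerI)
    fix h assume h: "h \<in> Arr A" "Cod A h = Dom A f" "f \<cdot> h = g \<cdot> h"
    obtain k where k: "k \<in> Arr A" "Dom A k = Dom A h" "Cod A k = Dom A e" "e \<cdot> k = h"
      using equalizer_factor[OF e h] by metis
    show "\<exists>k. k \<in> Arr A \<and> Dom A k = Dom A h \<and> Cod A k = Dom A (e \<cdot> u) \<and> (e \<cdot> u) \<cdot> k = h"
      by (rule exI[of _ "v \<cdot> k"]) (use d u v k comp_eq_extend[OF v(6)] in simp)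
  next
    fix k k' assume k: "k \<in> Arr A" "k' \<in> Arr A" "Dom A k' = Dom A k"
      "Cod A k = Dom A (e \<cdot> u)" "Cod A k' = Dom A (e \<cdot> u)" "(e \<cdot> u) \<cdot> k = (e \<cdot> u) \<cdot> k'"
    have "u \<cdot> k = u \<cdot> k'"
      by (rule equalizer_mono[OF e]) (use d u v k in simp_all)
    then have "v \<cdot> (u \<cdot> k) = v \<cdot> (u \<cdot> k')" by simp
    then show "k = k'"
      using d u v k comp_eq_extend[OF v(5)] by simp
  qed (use d u v comp_eq_extend[OF d(7)] in simp_all)
qed

lemma split_cofork_is_equalizer:
  assumes "split_cofork A e f g"
  shows "is_equalizer A e f g"
proof -
  from assms obtain p q where
    d: "f \<in> Arr A" "g \<in> Arr A" "Dom A g = Dom A f" "Cod A g = Cod A f"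
      "e \<in> Arr A" "Cod A e = Dom A f" "f \<cdot> e = g \<cdot> e"
      "p \<in> Arr A" "Dom A p = Dom A f" "Cod A p = Dom A e"
      "q \<in> Arr A" "Dom A q = Cod A f" "Cod A q = Dom A f"
    and pe: "p \<cdot> e = Id A (Dom A e)" and qf: "q \<cdot> f = Id A (Dom A f)" and ep: "e \<cdot> p = q \<cdot> g"
    by (auto simp: split_cofork_def parallel_def hom_iff)
  show ?thesis
  proof (rule equalizerI)
    fix h assume h: "h \<in> Arr A" "Cod A h = Dom A f" "f \<cdot> h = g \<cdot> h"
    have "e \<cdot> (p \<cdot> h) = q \<cdot> (g \<cdot> h)"
      using d h comp_eq_extend[OF ep] by simp
    also have "\<dots> = h"
      using d h(1,2) comp_eq_extend[OF qf] by (simp flip: h(3))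
    finally show "\<exists>k. k \<in> Arr A \<and> Dom A k = Dom A h \<and> Cod A k = Dom A e \<and> e \<cdot> k = h"
      using d h by (intro exI[of _ "p \<cdot> h"]) simp
  next
    fix k k' assume k: "k \<in> Arr A" "k' \<in> Arr A" "Dom A k' = Dom A k"
      "Cod A k = Dom A e" "Cod A k' = Dom A e" "e \<cdot> k = e \<cdot> k'"
    then have "p \<cdot> (e \<cdot> k) = p \<cdot> (e \<cdot> k')" by simp
    then show "k = k'"
      using d k(1-5) comp_eq_extend[OF pe] by simp
  qed (use d in simp_all)
qed

text \<open>Splittings move along an isomorphism of parallel pairs with components \<open>s\<close> and \<open>t\<close>: the maps
  \<open>p\<close> and \<open>q\<close> become \<open>p s\<close> and \<open>s' q t\<close>.\<close>

lemma split_cofork_transport: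
  assumes split: "split_cofork A e' f' g'"
    and s: "s \<in> Arr A" "s' \<in> Arr A" "Dom A s' = Cod A s" "Cod A s' = Dom A s"
      "s' \<cdot> s = Id A (Dom A s)" "s \<cdot> s' = Id A (Cod A s)"
    and t: "iso A t"
    and f: "f \<in> Arr A" "Dom A f = Dom A s" "Cod A f = Dom A t" "t \<cdot> f = f' \<cdot> s"
    and g: "g \<in> Arr A" "Dom A g = Dom A s" "Cod A g = Dom A t" "t \<cdot> g = g' \<cdot> s"
    and cod: "Cod A s = Dom A f'"
  shows "split_cofork A (s' \<cdot> e') f g"
proof -
  from split obtain p q where
    d: "f' \<in> Arr A" "g' \<in> Arr A" "Dom A g' = Dom A f'" "Cod A g' = Cod A f'"
      "e' \<in> Arr A" "Cod A e' = Dom A f'"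
      "p \<in> Arr A" "Dom A p = Dom A f'" "Cod A p = Dom A e'"
      "q \<in> Arr A" "Dom A q = Cod A f'" "Cod A q = Dom A f'"
    and fe: "f' \<cdot> e' = g' \<cdot> e'"
    and pe: "p \<cdot> e' = Id A (Dom A e')" and qf: "q \<cdot> f' = Id A (Dom A f')" and ep: "e' \<cdot> p = q \<cdot> g'"
    by (auto simp: split_cofork_def parallel_def hom_iff)
  from t obtain t' where
    t': "t \<in> Arr A" "t' \<in> Arr A" "Dom A t' = Cod A t" "Cod A t' = Dom A t"
      "t' \<cdot> t = Id A (Dom A t)" "t \<cdot> t' = Id A (Cod A t)"
    by (metis isoE)
  have cod_t: "Cod A t = Cod A f'"
    using comp_arr(3)[of f t] comp_arr(3)[of s f'] f s d t' cod by simp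
  have through: "k \<cdot> (s' \<cdot> e') = t' \<cdot> (k' \<cdot> e')"
    if "k \<in> Arr A" "Dom A k = Dom A s" "Cod A k = Dom A t" "t \<cdot> k = k' \<cdot> s"
      "k' \<in> Arr A" "Dom A k' = Dom A f'" for k k'
  proof -
    have "k \<cdot> (s' \<cdot> e') = t' \<cdot> (t \<cdot> (k \<cdot> (s' \<cdot> e')))"
      using that s d t' cod comp_eq_extend[OF t'(5)] by simp
    also have "\<dots> = t' \<cdot> (k' \<cdot> (s \<cdot> (s' \<cdot> e')))"
      using that s d t' cod comp_eq_extend[OF that(4)] by simp
    also have "\<dots> = t' \<cdot> (k' \<cdot> e')"
      using that s d t' cod comp_eq_extend[OF s(6)] by simp
    finally show ?thesis .
  qed
  have "f \<cdot> (s' \<cdot> e') = g \<cdot> (s' \<cdot> e')"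
    using through[OF f d(1) refl] through[OF g d(2) d(3)] fe by simp
  moreover have "(p \<cdot> s) \<cdot> (s' \<cdot> e') = Id A (Dom A (s' \<cdot> e'))"
    using d s cod pe comp_eq_extend[OF s(6)] by simp
  moreover have "(s' \<cdot> (q \<cdot> t)) \<cdot> f = Id A (Dom A f)"
    using d s cod f t' cod_t comp_eq_extend[OF qf] by simp
  moreover have "(s' \<cdot> e') \<cdot> (p \<cdot> s) = (s' \<cdot> (q \<cdot> t)) \<cdot> g"
    using d s cod g t' cod_t comp_eq_extend[OF ep] by simp
  ultimately show ?thesis
    unfolding split_cofork_def parallel_def
    using d s f g t' cod cod_t
    by (intro conjI bexI[of _ "p \<cdot> s"] bexI[of _ "s' \<cdot> (q \<cdot> t)"]) (simp_all add: hom_iff)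
qed

end

section \<open>Functors, natural isomorphisms and universal arrows\<close>

context cat_functor
begin

declare omap_obj [simp] amap_id [simp]

lemma map_arr [simp]:
  assumes "f \<in> Arr A"
  shows "amap F f \<in> Arr B" "Dom B (amap F f) = omap F (Dom A f)"
    "Cod B (amap F f) = omap F (Cod A f)"
  using amap_hom[of f "Dom A f" "Cod A f"] assms by (auto simp: hom_iff)

lemma map_comp:
  assumes "f \<in> Arr A" "g \<in> Arr A" "Cod A f = Dom A g"
  shows "amap F (g \<cdot>\<^bsub>A\<^esub> f) = amap F g \<cdot>\<^bsub>B\<^esub> amap F f"
  using amap_comp[of f "Dom A f" "Cod A f" g "Cod A g"] assms by (simp add: hom_iff)

lemma map_iso:
  assumes "iso A f"
  shows "iso B (amap F f)"
proof -
  from assms obtain g where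
    g: "f \<in> Arr A" "g \<in> Arr A" "Dom A g = Cod A f" "Cod A g = Dom A f"
      "g \<cdot>\<^bsub>A\<^esub> f = Id A (Dom A f)" "f \<cdot>\<^bsub>A\<^esub> g = Id A (Cod A f)"
    by (metis A.isoE)
  show ?thesis
    by (rule B.isoI[of _ "amap F g"]) (use g in \<open>simp_all flip: map_comp\<close>)
qed

end

context nat_trans
begin

lemma component_arr [simp]:
  assumes "X \<in> Obj A"
  shows "t X \<in> Arr B" "Dom B (t X) = omap F X" "Cod B (t X) = omap G X"
  using component[OF assms] by (auto simp: hom_iff)

lemma natural:
  assumes "f \<in> Arr A"
  shows "t (Cod A f) \<cdot>\<^bsub>B\<^esub> amap F f = amap G f \<cdot>\<^bsub>B\<^esub> t (Dom A f)"
  using naturality[of f "Dom A f" "Cod A f"] assms by (simp add: hom_iff)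

text \<open>Chosen inverses of the components are natural automatically: insert the identity \<open>t X \<cdot> s X\<close>
  and use the naturality of \<open>t\<close>.\<close>

lemma invertible_iff_components_iso:
  "invertible_trans A B F G t \<longleftrightarrow> (\<forall>X \<in> Obj A. iso B (t X))"
proof
  assume "invertible_trans A B F G t"
  then show "\<forall>X \<in> Obj A. iso B (t X)"
    by (auto simp: invertible_trans_def iso_def intro: nat_trans.component)
next
  assume iso: "\<forall>X \<in> Obj A. iso B (t X)"
  have "\<forall>X \<in> Obj A. \<exists>g. g \<in> hom B (omap G X) (omap F X) \<and>
    g \<cdot>\<^bsub>B\<^esub> t X = Id B (omap F X) \<and> t X \<cdot>\<^bsub>B\<^esub> g = Id B (omap G X)"
    using iso by (auto simp: iso_def)
  from bchoice[OF this] obtain s where s_inv: "\<forall>X \<in> Obj A. s X \<in> hom B (omap G X) (omap F X) \<and>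
    s X \<cdot>\<^bsub>B\<^esub> t X = Id B (omap F X) \<and> t X \<cdot>\<^bsub>B\<^esub> s X = Id B (omap G X)"
    by blast
  have s: "s X \<in> Arr B" "Dom B (s X) = omap G X" "Cod B (s X) = omap F X"
      "s X \<cdot>\<^bsub>B\<^esub> t X = Id B (omap F X)" "t X \<cdot>\<^bsub>B\<^esub> s X = Id B (omap G X)"
    if "X \<in> Obj A" for X
    using s_inv[rule_format, OF that] by (auto simp: hom_iff)
  have "s Y \<cdot>\<^bsub>B\<^esub> amap G f = amap F f \<cdot>\<^bsub>B\<^esub> s X" if "f \<in> hom A X Y" for f X Y
  proof -
    from that have f: "f \<in> Arr A" "Dom A f = X" "Cod A f = Y" "X \<in> Obj A" "Y \<in> Obj A"
      by (auto simp: hom_iff)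
    note [simp] = s[OF f(4)] s[OF f(5)]
    have "s Y \<cdot>\<^bsub>B\<^esub> amap G f = s Y \<cdot>\<^bsub>B\<^esub> ((amap G f \<cdot>\<^bsub>B\<^esub> t X) \<cdot>\<^bsub>B\<^esub> s X)"
      using f by simp
    also have "\<dots> = s Y \<cdot>\<^bsub>B\<^esub> ((t Y \<cdot>\<^bsub>B\<^esub> amap F f) \<cdot>\<^bsub>B\<^esub> s X)"
      using natural[OF f(1)] f by simp
    also have "\<dots> = amap F f \<cdot>\<^bsub>B\<^esub> s X"
      using f F.B.comp_eq_extend[OF s(4)[OF f(5)]] by simp
    finally show ?thesis .
  qed
  then have "nat_trans A B G F s"
    by unfold_locales (use s in \<open>auto simp: hom_iff\<close>)
  then show "invertible_trans A B F G t"
    unfolding invertible_trans_def using nat_trans_axioms s by blast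
qed

end

text \<open>The arrow \<open>p\<close> makes \<open>x\<close> represent the functor that sends \<open>w\<close> to the arrows from \<open>F w\<close> to
  \<open>y\<close>; such an \<open>x\<close> is the value at \<open>y\<close> of a right adjoint of \<open>F\<close>.\<close>

definition universal_arrow ::
    "('o, 'a) cat \<Rightarrow> ('p, 'b) cat \<Rightarrow> ('o, 'a, 'p, 'b) func \<Rightarrow> 'o \<Rightarrow> 'p \<Rightarrow> 'b \<Rightarrow> bool" where
  "universal_arrow A B F x y p \<longleftrightarrow> x \<in> Obj A \<and> p \<in> hom B (omap F x) y \<and>
     (\<forall>w \<in> Obj A. \<forall>f \<in> hom B (omap F w) y. \<exists>!k. k \<in> hom A w x \<and> p \<cdot>\<^bsub>B\<^esub> amap F k = f)"

context cat_functor
begin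

lemma universal_arrowD:
  assumes "universal_arrow A B F x y p"
  shows "x \<in> Obj A" "p \<in> Arr B" "Dom B p = omap F x" "Cod B p = y"
proof -
  have "x \<in> Obj A \<and> p \<in> hom B (omap F x) y"
    using assms unfolding universal_arrow_def by blast
  then show "x \<in> Obj A" "p \<in> Arr B" "Dom B p = omap F x" "Cod B p = y"
    by (simp_all add: hom_iff)
qed

lemma universal_arrow_factor:
  assumes "universal_arrow A B F x y p"
    and "w \<in> Obj A" "f \<in> Arr B" "Dom B f = omap F w" "Cod B f = y"
  obtains k where "k \<in> Arr A" "Dom A k = w" "Cod A k = x" "p \<cdot>\<^bsub>B\<^esub> amap F k = f"
proof -
  have "f \<in> hom B (omap F w) y"
    using assms by (simp add: hom_iff)
  then obtain k where "k \<in> hom A w x" "p \<cdot>\<^bsub>B\<^esub> amap F k = f"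
    using assms(1,2) unfolding universal_arrow_def by blast
  then show thesis
    by (auto simp: hom_iff intro: that)
qed

lemma universal_arrow_unique:
  assumes p: "universal_arrow A B F x y p"
    and k: "k \<in> Arr A" "Cod A k = x" and k': "k' \<in> Arr A" "Dom A k' = Dom A k" "Cod A k' = x"
    and same: "p \<cdot>\<^bsub>B\<^esub> amap F k = p \<cdot>\<^bsub>B\<^esub> amap F k'"
  shows "k = k'"
proof -
  have "Dom A k \<in> Obj A" "p \<cdot>\<^bsub>B\<^esub> amap F k' \<in> hom B (omap F (Dom A k)) y"
    "k \<in> hom A (Dom A k) x" "k' \<in> hom A (Dom A k) x"
    using universal_arrowD[OF p] k k' by (simp_all add: hom_iff)
  then show ?thesis
    using p same unfolding universal_arrow_def by blast
qed

lemma universal_arrows_iso: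
  assumes p: "universal_arrow A B F x y p" and q: "universal_arrow A B F x' y q"
  obtains u where "iso A u" "Dom A u = x'" "Cod A u = x" "p \<cdot>\<^bsub>B\<^esub> amap F u = q"
proof -
  have x: "x \<in> Obj A" "x' \<in> Obj A"
    and pq: "p \<in> Arr B" "Dom B p = omap F x" "Cod B p = y"
      "q \<in> Arr B" "Dom B q = omap F x'" "Cod B q = y"
    using universal_arrowD[OF p] universal_arrowD[OF q] by simp_all
  obtain u where u: "u \<in> Arr A" "Dom A u = x'" "Cod A u = x" "p \<cdot>\<^bsub>B\<^esub> amap F u = q"
    using universal_arrow_factor[OF p x(2) pq(4-6)] .
  obtain v where v: "v \<in> Arr A" "Dom A v = x" "Cod A v = x'" "q \<cdot>\<^bsub>B\<^esub> amap F v = p"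
    using universal_arrow_factor[OF q x(1) pq(1-3)] .
  have "u \<cdot>\<^bsub>A\<^esub> v = Id A x"
    by (rule universal_arrow_unique[OF p])
      (use x pq u v B.comp_eq_extend[OF u(4)] in \<open>simp_all add: map_comp hom_iff\<close>)
  moreover have "v \<cdot>\<^bsub>A\<^esub> u = Id A x'"
    by (rule universal_arrow_unique[OF q])
      (use x pq u v B.comp_eq_extend[OF v(4)] in \<open>simp_all add: map_comp hom_iff\<close>)
  ultimately have "iso A u"
    using u v by (auto intro: A.isoI[of u v])
  then show thesis
    using that u by blast
qed

text \<open>Every law still to be checked (functoriality of \<open>G\<close>, naturality of \<open>\<eta>\<close>, the second
  triangle) equates two arrows into some \<open>G y\<close>. It suffices to compare them after applying \<open>F\<close> and
  composing with \<open>\<xi> y\<close>, so the action of \<open>G\<close> on arrows and the unit enter only through their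
  composites with \<open>\<xi>\<close>.\<close>

lemma adjunction_of_universal_arrows:
  assumes univ: "\<And>y. y \<in> Obj B \<Longrightarrow> universal_arrow A B F (omap G y) y (\<xi> y)"
    and G: "\<And>g y z. g \<in> hom B y z \<Longrightarrow> amap G g \<in> hom A (omap G y) (omap G z) \<and>
      \<xi> z \<cdot>\<^bsub>B\<^esub> amap F (amap G g) = g \<cdot>\<^bsub>B\<^esub> \<xi> y"
    and unit: "\<And>x. x \<in> Obj A \<Longrightarrow> \<eta> x \<in> hom A x (omap G (omap F x)) \<and>
      \<xi> (omap F x) \<cdot>\<^bsub>B\<^esub> amap F (\<eta> x) = Id B (omap F x)"
  shows "adjunction A B F G \<eta> \<xi>"
proof -
  have Go [simp]: "omap G y \<in> Obj A"
    and xi [simp]: "\<xi> y \<in> Arr B" "Dom B (\<xi> y) = omap F (omap G y)" "Cod B (\<xi> y) = y"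
    if "y \<in> Obj B" for y
    using universal_arrowD[OF univ[OF that]] by simp_all
  have Ga [simp]: "amap G g \<in> Arr A" "Dom A (amap G g) = omap G (Dom B g)"
      "Cod A (amap G g) = omap G (Cod B g)"
    and xi_nat: "\<xi> (Cod B g) \<cdot>\<^bsub>B\<^esub> amap F (amap G g) = g \<cdot>\<^bsub>B\<^esub> \<xi> (Dom B g)"
    if "g \<in> Arr B" for g
    using G[of g "Dom B g" "Cod B g"] that by (auto simp: hom_iff)
  have eta [simp]: "\<eta> x \<in> Arr A" "Dom A (\<eta> x) = x" "Cod A (\<eta> x) = omap G (omap F x)"
    and triangle: "\<xi> (omap F x) \<cdot>\<^bsub>B\<^esub> amap F (\<eta> x) = Id B (omap F x)"
    if "x \<in> Obj A" for x
    using unit[OF that] by (auto simp: hom_iff)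
  have G_id: "amap G (Id B y) = Id A (omap G y)" if y: "y \<in> Obj B" for y
    by (rule universal_arrow_unique[OF univ[OF y]])
      (use y xi_nat[of "Id B y"] in \<open>simp_all add: hom_iff\<close>)
  have G_comp: "amap G (g \<cdot>\<^bsub>B\<^esub> f) = amap G g \<cdot>\<^bsub>A\<^esub> amap G f"
    if f: "f \<in> hom B x y" and g: "g \<in> hom B y z" for f g x y z
  proof -
    have fg: "f \<in> Arr B" "g \<in> Arr B" "Dom B f = x" "Cod B f = y" "Dom B g = y" "Cod B g = z"
      "x \<in> Obj B" "y \<in> Obj B" "z \<in> Obj B"
      using f g by (auto simp: hom_iff)
    show ?thesis
    proof (rule universal_arrow_unique[OF univ[OF fg(9)]])
      have "\<xi> z \<cdot>\<^bsub>B\<^esub> amap F (amap G g \<cdot>\<^bsub>A\<^esub> amap G f) = g \<cdot>\<^bsub>B\<^esub> (\<xi> y \<cdot>\<^bsub>B\<^esub> amap F (amap G f))"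
        using fg B.comp_eq_extend[OF xi_nat[OF fg(2)]] by (simp add: map_comp)
      also have "\<dots> = (g \<cdot>\<^bsub>B\<^esub> f) \<cdot>\<^bsub>B\<^esub> \<xi> x"
        using fg xi_nat[OF fg(1)] by simp
      finally show "\<xi> z \<cdot>\<^bsub>B\<^esub> amap F (amap G (g \<cdot>\<^bsub>B\<^esub> f)) = \<xi> z \<cdot>\<^bsub>B\<^esub> amap F (amap G g \<cdot>\<^bsub>A\<^esub> amap G f)"
        using fg xi_nat[of "g \<cdot>\<^bsub>B\<^esub> f"] by simp
    qed (use fg in \<open>simp_all add: hom_iff\<close>)
  qed
  interpret G: cat_functor B A G
    by unfold_locales (use G_id G_comp in \<open>auto simp: hom_iff\<close>)
  have eta_nat: "\<eta> y \<cdot>\<^bsub>A\<^esub> f = amap G (amap F f) \<cdot>\<^bsub>A\<^esub> \<eta> x" if "f \<in> hom A x y" for f x y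
  proof -
    have f: "f \<in> Arr A" "Dom A f = x" "Cod A f = y" "x \<in> Obj A" "y \<in> Obj A"
      using that by (auto simp: hom_iff)
    show ?thesis
    proof (rule universal_arrow_unique[OF univ[of "omap F y"]])
      have "\<xi> (omap F y) \<cdot>\<^bsub>B\<^esub> amap F (\<eta> y \<cdot>\<^bsub>A\<^esub> f) = amap F f"
        using f B.comp_eq_extend[OF triangle[OF f(5)]] by (simp add: map_comp)
      also have "\<dots> = \<xi> (omap F y) \<cdot>\<^bsub>B\<^esub> amap F (amap G (amap F f) \<cdot>\<^bsub>A\<^esub> \<eta> x)"
        using f triangle[OF f(4)] B.comp_eq_extend[OF xi_nat[of "amap F f"]]
        by (simp add: map_comp)
      finally show "\<xi> (omap F y) \<cdot>\<^bsub>B\<^esub> amap F (\<eta> y \<cdot>\<^bsub>A\<^esub> f) =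
        \<xi> (omap F y) \<cdot>\<^bsub>B\<^esub> amap F (amap G (amap F f) \<cdot>\<^bsub>A\<^esub> \<eta> x)" .
    qed (use f in \<open>simp_all add: hom_iff\<close>)
  qed
  have triangle': "amap G (\<xi> y) \<cdot>\<^bsub>A\<^esub> \<eta> (omap G y) = Id A (omap G y)" if y: "y \<in> Obj B" for y
  proof (rule universal_arrow_unique[OF univ[OF y]])
    show "\<xi> y \<cdot>\<^bsub>B\<^esub> amap F (amap G (\<xi> y) \<cdot>\<^bsub>A\<^esub> \<eta> (omap G y)) = \<xi> y \<cdot>\<^bsub>B\<^esub> amap F (Id A (omap G y))"
      using y triangle[of "omap G y"] B.comp_eq_extend[OF xi_nat[of "\<xi> y"]]
      by (simp add: map_comp)
  qed (use y in \<open>simp_all add: hom_iff\<close>)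
  have xi_nat': "\<xi> z \<cdot>\<^bsub>B\<^esub> amap F (amap G g) = g \<cdot>\<^bsub>B\<^esub> \<xi> y" if "g \<in> hom B y z" for g y z
    using G[OF that] by simp
  show ?thesis
    by unfold_locales (auto simp: hom_iff map_comp G.map_comp triangle triangle' eta_nat xi_nat')
qed

end

section \<open>Coalgebras over a comonad\<close>

lemma coalg_cat_sel [simp]:
  shows Obj_coalg: "Obj (coalg_cat A C) = coalgebras A C"
    and Dom_coalg: "Dom (coalg_cat A C) k = fst k"
    and Cod_coalg: "Cod (coalg_cat A C) k = snd (snd k)"
    and Id_coalg: "Id (coalg_cat A C) x = (x, Id A (fst x), x)"
    and Comp_coalg: "k' \<cdot>\<^bsub>coalg_cat A C\<^esub> k = (fst k, und k' \<cdot>\<^bsub>A\<^esub> und k, snd (snd k'))"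
  by (simp_all add: coalg_cat_def case_prod_beta)

lemma cofree_sel [simp]: "fst (cofree C X) = omap (fn C) X" "snd (cofree C X) = \<delta>\<^bsub>C\<^esub> X"
  by (simp_all add: cofree_def)

context comonad
begin

lemma coalgebra_iff:
  "x \<in> coalgebras A C \<longleftrightarrow> fst x \<in> Obj A \<and> snd x \<in> Arr A \<and> Dom A (snd x) = fst x \<and>
    Cod A (snd x) = omap (fn C) (fst x) \<and>
    \<delta>\<^bsub>C\<^esub> (fst x) \<cdot>\<^bsub>A\<^esub> snd x = amap (fn C) (snd x) \<cdot>\<^bsub>A\<^esub> snd x \<and>
    \<epsilon>\<^bsub>C\<^esub> (fst x) \<cdot>\<^bsub>A\<^esub> snd x = Id A (fst x)"
  by (auto simp: coalgebras_def hom_iff)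

lemma coalg_arr_iff:
  "k \<in> Arr (coalg_cat A C) \<longleftrightarrow> fst k \<in> coalgebras A C \<and> snd (snd k) \<in> coalgebras A C \<and>
    und k \<in> Arr A \<and> Dom A (und k) = fst (fst k) \<and> Cod A (und k) = fst (snd (snd k)) \<and>
    snd (snd (snd k)) \<cdot>\<^bsub>A\<^esub> und k = amap (fn C) (und k) \<cdot>\<^bsub>A\<^esub> snd (fst k)"
  by (auto simp: coalg_cat_def hom_iff)

text \<open>In this form the characterisation matches only a displayed triple, so it can be used for
  rewriting together with the projections in \<open>coalg_arrD\<close>.\<close>

lemma coalg_triple_iff:
  "(x, f, y) \<in> Arr (coalg_cat A C) \<longleftrightarrow> x \<in> coalgebras A C \<and> y \<in> coalgebras A C \<and>
    f \<in> Arr A \<and> Dom A f = fst x \<and> Cod A f = fst y \<and>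
    snd y \<cdot>\<^bsub>A\<^esub> f = amap (fn C) f \<cdot>\<^bsub>A\<^esub> snd x"
  by (simp add: coalg_arr_iff)

lemma coalgebraD [simp]:
  assumes "x \<in> coalgebras A C"
  shows "fst x \<in> Obj A" "snd x \<in> Arr A" "Dom A (snd x) = fst x" "Cod A (snd x) = omap (fn C) (fst x)"
  using assms unfolding coalgebra_iff by blast+

lemma coalgebra_laws:
  assumes "x \<in> coalgebras A C"
  shows "\<delta>\<^bsub>C\<^esub> (fst x) \<cdot>\<^bsub>A\<^esub> snd x = amap (fn C) (snd x) \<cdot>\<^bsub>A\<^esub> snd x"
    and "\<epsilon>\<^bsub>C\<^esub> (fst x) \<cdot>\<^bsub>A\<^esub> snd x = Id A (fst x)"
  using assms unfolding coalgebra_iff by blast+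

lemma coalg_arrD [simp]:
  assumes "k \<in> Arr (coalg_cat A C)"
  shows "fst k \<in> coalgebras A C" "snd (snd k) \<in> coalgebras A C"
    "und k \<in> Arr A" "Dom A (und k) = fst (fst k)" "Cod A (und k) = fst (snd (snd k))"
  using assms unfolding coalg_arr_iff by blast+

lemma coalg_arr_law:
  assumes "k \<in> Arr (coalg_cat A C)"
  shows "snd (snd (snd k)) \<cdot>\<^bsub>A\<^esub> und k = amap (fn C) (und k) \<cdot>\<^bsub>A\<^esub> snd (fst k)"
  using assms unfolding coalg_arr_iff by blast

lemma comult_natural:
  assumes "f \<in> Arr A"
  shows "\<delta>\<^bsub>C\<^esub> (Cod A f) \<cdot>\<^bsub>A\<^esub> amap (fn C) f = amap (fn C) (amap (fn C) f) \<cdot>\<^bsub>A\<^esub> \<delta>\<^bsub>C\<^esub> (Dom A f)"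
  using comult.natural[OF assms] by simp

lemma counit_natural:
  assumes "f \<in> Arr A"
  shows "\<epsilon>\<^bsub>C\<^esub> (Cod A f) \<cdot>\<^bsub>A\<^esub> amap (fn C) f = f \<cdot>\<^bsub>A\<^esub> \<epsilon>\<^bsub>C\<^esub> (Dom A f)"
  using counit.natural[OF assms] by simp

lemma coalg_arr_comp:
  assumes "k \<in> Arr (coalg_cat A C)" "k' \<in> Arr (coalg_cat A C)" "snd (snd k) = fst k'"
  shows "(fst k, und k' \<cdot>\<^bsub>A\<^esub> und k, snd (snd k')) \<in> Arr (coalg_cat A C)"
  using assms F.A.comp_eq_extend[OF coalg_arr_law[OF assms(2)]] coalg_arr_law[OF assms(1)]
  by (simp add: coalg_triple_iff F.map_comp)

sublocale coalg: category "coalg_cat A C"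
proof
  fix k x y k' z assume "k \<in> hom (coalg_cat A C) x y" "k' \<in> hom (coalg_cat A C) y z"
  then show "k' \<cdot>\<^bsub>coalg_cat A C\<^esub> k \<in> hom (coalg_cat A C) x z"
    using coalg_arr_comp[of k k'] by (auto simp: hom_iff)
qed (auto simp: hom_iff coalg_triple_iff prod_eq_iff)

lemma cofree_coalgebra [simp]: "X \<in> Obj A \<Longrightarrow> cofree C X \<in> coalgebras A C"
  unfolding coalgebra_iff by (simp add: coassoc counit_left)

lemma cofree_map [simp]:
  "f \<in> Arr A \<Longrightarrow> (cofree C (Dom A f), amap (fn C) f, cofree C (Cod A f)) \<in> Arr (coalg_cat A C)"
  by (simp add: coalg_triple_iff comult_natural)

text \<open>This lemma and the next two express that the cofree coalgebra is right adjoint to the forgetful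
  functor: morphisms into it correspond to arrows into \<open>Y\<close>, by composition with the counit.\<close>

lemma transpose_coalg_arr:
  assumes "x \<in> coalgebras A C" "f \<in> Arr A" "Dom A f = fst x" "Cod A f = Y"
  shows "(x, amap (fn C) f \<cdot>\<^bsub>A\<^esub> snd x, cofree C Y) \<in> Arr (coalg_cat A C)"
proof -
  have Y: "Y \<in> Obj A"
    using assms F.A.cod_obj by blast
  have "\<delta>\<^bsub>C\<^esub> (Cod A f) \<cdot>\<^bsub>A\<^esub> (amap (fn C) f \<cdot>\<^bsub>A\<^esub> snd x)
      = amap (fn C) (amap (fn C) f) \<cdot>\<^bsub>A\<^esub> (\<delta>\<^bsub>C\<^esub> (fst x) \<cdot>\<^bsub>A\<^esub> snd x)"
    using assms Y F.A.comp_eq_extend[OF comult_natural[of f]] by simp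
  then show ?thesis
    using assms Y by (auto simp: coalg_triple_iff coalgebra_laws F.map_comp)
qed

lemma counit_transpose:
  assumes "x \<in> coalgebras A C" "f \<in> Arr A" "Dom A f = fst x" "Cod A f = Y"
  shows "\<epsilon>\<^bsub>C\<^esub> Y \<cdot>\<^bsub>A\<^esub> (amap (fn C) f \<cdot>\<^bsub>A\<^esub> snd x) = f"
proof -
  have Y: "Y \<in> Obj A"
    using assms F.A.cod_obj by blast
  show ?thesis
    using assms Y F.A.comp_eq_extend[OF counit_natural[of f]] by (simp add: coalgebra_laws)
qed

lemma transpose_counit:
  assumes "k \<in> Arr (coalg_cat A C)" "snd (snd k) = cofree C Y" "Y \<in> Obj A"
  shows "amap (fn C) (\<epsilon>\<^bsub>C\<^esub> Y \<cdot>\<^bsub>A\<^esub> und k) \<cdot>\<^bsub>A\<^esub> snd (fst k) = und k"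
proof -
  have "amap (fn C) (\<epsilon>\<^bsub>C\<^esub> Y) \<cdot>\<^bsub>A\<^esub> (\<delta>\<^bsub>C\<^esub> Y \<cdot>\<^bsub>A\<^esub> und k) = und k"
    using assms F.A.comp_eq_extend[OF counit_right[of Y]] by simp
  then show ?thesis
    using assms coalg_arr_law[OF assms(1)] by (simp add: F.map_comp)
qed

text \<open>The splitting consists of counits: \<open>c \<circ> \<epsilon>\<^sub>X = \<epsilon> \<circ> C c\<close> is the naturality of \<open>\<epsilon>\<close>.\<close>

lemma coalgebra_split_cofork:
  assumes x: "x \<in> coalgebras A C"
  shows "split_cofork A (snd x) (\<delta>\<^bsub>C\<^esub> (fst x)) (amap (fn C) (snd x))"
proof -
  note X = coalgebraD[OF x]
  have "snd x \<cdot>\<^bsub>A\<^esub> \<epsilon>\<^bsub>C\<^esub> (fst x) = \<epsilon>\<^bsub>C\<^esub> (omap (fn C) (fst x)) \<cdot>\<^bsub>A\<^esub> amap (fn C) (snd x)"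
    using X counit_natural[of "snd x"] by simp
  then show ?thesis
    unfolding split_cofork_def parallel_def
    using X coalgebra_laws[OF x] counit_left[of "fst x"]
    by (intro conjI bexI[of _ "\<epsilon>\<^bsub>C\<^esub> (fst x)"] bexI[of _ "\<epsilon>\<^bsub>C\<^esub> (omap (fn C) (fst x))"])
      (simp_all add: hom_iff)
qed

text \<open>The inverse of an underlying isomorphism is compatible with the coalgebra structures: compose
  the square of \<open>k\<close> with the inverse on both sides.\<close>

lemma iso_coalg_iff:
  assumes k: "k \<in> Arr (coalg_cat A C)"
  shows "iso (coalg_cat A C) k \<longleftrightarrow> iso A (und k)"
proof
  assume "iso (coalg_cat A C) k"
  then obtain g where
    g: "g \<in> Arr (coalg_cat A C)" "fst g = snd (snd k)" "snd (snd g) = fst k"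
      "und g \<cdot>\<^bsub>A\<^esub> und k = Id A (fst (fst k))" "und k \<cdot>\<^bsub>A\<^esub> und g = Id A (fst (snd (snd k)))"
    by (rule coalg.isoE) simp
  then show "iso A (und k)"
    using k coalg_arrD[OF g(1)] by (intro F.A.isoI[of _ "und g"]) simp_all
next
  assume "iso A (und k)"
  then obtain g where
    g: "g \<in> Arr A" "Dom A g = fst (snd (snd k))" "Cod A g = fst (fst k)"
      "g \<cdot>\<^bsub>A\<^esub> und k = Id A (fst (fst k))" "und k \<cdot>\<^bsub>A\<^esub> g = Id A (fst (snd (snd k)))"
    using k by (auto elim: F.A.isoE)
  have "amap (fn C) g \<cdot>\<^bsub>A\<^esub> (snd (snd (snd k)) \<cdot>\<^bsub>A\<^esub> (und k \<cdot>\<^bsub>A\<^esub> g))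
      = amap (fn C) (g \<cdot>\<^bsub>A\<^esub> und k) \<cdot>\<^bsub>A\<^esub> (snd (fst k) \<cdot>\<^bsub>A\<^esub> g)"
    using k g(1-3) F.A.comp_eq_extend[OF coalg_arr_law[OF k]] by (simp add: F.map_comp)
  then have "amap (fn C) g \<cdot>\<^bsub>A\<^esub> snd (snd (snd k)) = snd (fst k) \<cdot>\<^bsub>A\<^esub> g"
    using k g by simp
  then have "(snd (snd k), g, fst k) \<in> Arr (coalg_cat A C)"
    using k g by (simp add: coalg_triple_iff)
  then show "iso (coalg_cat A C) k"
    by (rule coalg.isoI[OF k]) (use k g in auto)
qed

text \<open>Because \<open>C e\<close> is an equalizer, the coalgebra structure of the common source restricts along \<open>e\<close>
  to a structure \<open>c\<close>. Its counit law holds after composition with the monomorphism \<open>e\<close>, its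
  coassociativity after composition with \<open>C\<^sup>2 e\<close>; this is where the second power of \<open>C\<close> enters.
  Factorisations through \<open>e\<close> are coalgebra morphisms because \<open>C e\<close> is a monomorphism.\<close>

lemma coalg_equalizer_lift:
  assumes l: "l \<in> Arr (coalg_cat A C)" and r: "r \<in> Arr (coalg_cat A C)"
    and par: "fst r = fst l" "snd (snd r) = snd (snd l)"
    and e: "is_equalizer A e (und l) (und r)"
    and Ce: "is_equalizer A (amap (fn C) e) (amap (fn C) (und l)) (amap (fn C) (und r))"
    and CCe: "is_equalizer A (amap (fn C \<circ>\<^sub>F fn C) e) (amap (fn C \<circ>\<^sub>F fn C) (und l))
      (amap (fn C \<circ>\<^sub>F fn C) (und r))"
  obtains c where "is_equalizer (coalg_cat A C) ((Dom A e, c), e, fst l) l r"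
proof -
  let ?E = "Dom A e" and ?X = "fst (fst l)" and ?a = "snd (fst l)"
  note d = F.A.equalizerD[OF e]
  have X: "fst l \<in> coalgebras A C" and e_cod: "Cod A e = ?X"
    using l d by simp_all
  have C_eq: "amap (fn C) (und l) \<cdot>\<^bsub>A\<^esub> (?a \<cdot>\<^bsub>A\<^esub> e) = amap (fn C) (und r) \<cdot>\<^bsub>A\<^esub> (?a \<cdot>\<^bsub>A\<^esub> e)"
  proof -
    have "amap (fn C) (und l) \<cdot>\<^bsub>A\<^esub> (?a \<cdot>\<^bsub>A\<^esub> e) = snd (snd (snd l)) \<cdot>\<^bsub>A\<^esub> (und l \<cdot>\<^bsub>A\<^esub> e)"
      using F.A.comp_eq_extend[OF coalg_arr_law[OF l], of e] l d(5) e_cod by simp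
    moreover have "amap (fn C) (und r) \<cdot>\<^bsub>A\<^esub> (?a \<cdot>\<^bsub>A\<^esub> e) = snd (snd (snd l)) \<cdot>\<^bsub>A\<^esub> (und r \<cdot>\<^bsub>A\<^esub> e)"
      using F.A.comp_eq_extend[OF coalg_arr_law[OF r], of e] r par l d(5) e_cod by simp
    ultimately show ?thesis
      using d(7) by simp
  qed
  \<comment> \<open>The structure \<open>c\<close> is the factorisation of \<open>?a \<circ> e\<close>, which equalizes the \<open>C\<close>-image
    of the pair.\<close>
  obtain c where c: "c \<in> Arr A" "Dom A c = ?E" "Cod A c = omap (fn C) ?E"
    and Ce_c: "amap (fn C) e \<cdot>\<^bsub>A\<^esub> c = ?a \<cdot>\<^bsub>A\<^esub> e"
    using F.A.equalizer_factor[OF Ce _ _ C_eq] d(5) e_cod X l by auto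
  have "e \<cdot>\<^bsub>A\<^esub> (\<epsilon>\<^bsub>C\<^esub> ?E \<cdot>\<^bsub>A\<^esub> c) = \<epsilon>\<^bsub>C\<^esub> ?X \<cdot>\<^bsub>A\<^esub> (amap (fn C) e \<cdot>\<^bsub>A\<^esub> c)"
    using F.A.comp_eq_extend[OF counit_natural[OF d(5)], of c] c d(5) e_cod X by simp
  also have "\<dots> = e"
    unfolding Ce_c using F.A.comp_eq_extend[OF coalgebra_laws(2)[OF X], of e] d(5) e_cod X by simp
  finally have "e \<cdot>\<^bsub>A\<^esub> (\<epsilon>\<^bsub>C\<^esub> ?E \<cdot>\<^bsub>A\<^esub> c) = e" .
  then have counit_c: "\<epsilon>\<^bsub>C\<^esub> ?E \<cdot>\<^bsub>A\<^esub> c = Id A ?E"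
    using c d(5) by - (rule F.A.equalizer_mono[OF e], simp_all)
  have "amap (fn C) (amap (fn C) e) \<cdot>\<^bsub>A\<^esub> (\<delta>\<^bsub>C\<^esub> ?E \<cdot>\<^bsub>A\<^esub> c) = \<delta>\<^bsub>C\<^esub> ?X \<cdot>\<^bsub>A\<^esub> (amap (fn C) e \<cdot>\<^bsub>A\<^esub> c)"
    using F.A.comp_eq_extend[OF comult_natural[OF d(5)], of c] c d(5) e_cod X by simp
  also have "\<dots> = amap (fn C) ?a \<cdot>\<^bsub>A\<^esub> (?a \<cdot>\<^bsub>A\<^esub> e)"
    unfolding Ce_c using F.A.comp_eq_extend[OF coalgebra_laws(1)[OF X], of e] d(5) e_cod X by simp
  also have "\<dots> = amap (fn C) (amap (fn C) e \<cdot>\<^bsub>A\<^esub> c) \<cdot>\<^bsub>A\<^esub> c"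
    unfolding Ce_c[symmetric] using X d(5) e_cod c by (simp add: F.map_comp Ce_c)
  also have "\<dots> = amap (fn C) (amap (fn C) e) \<cdot>\<^bsub>A\<^esub> (amap (fn C) c \<cdot>\<^bsub>A\<^esub> c)"
    using c d(5) by (simp add: F.map_comp)
  finally have "amap (fn C) (amap (fn C) e) \<cdot>\<^bsub>A\<^esub> (\<delta>\<^bsub>C\<^esub> ?E \<cdot>\<^bsub>A\<^esub> c)
      = amap (fn C) (amap (fn C) e) \<cdot>\<^bsub>A\<^esub> (amap (fn C) c \<cdot>\<^bsub>A\<^esub> c)" .
  then have comult_c: "\<delta>\<^bsub>C\<^esub> ?E \<cdot>\<^bsub>A\<^esub> c = amap (fn C) c \<cdot>\<^bsub>A\<^esub> c"
    using c d(5) by - (rule F.A.equalizer_mono[OF CCe], simp_all)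
  have E: "(?E, c) \<in> coalgebras A C"
    unfolding coalgebra_iff using c d(5) counit_c comult_c by simp
  have e_arr: "((?E, c), e, fst l) \<in> Arr (coalg_cat A C)"
    using E X d(5) e_cod Ce_c by (simp add: coalg_triple_iff)
  have "is_equalizer (coalg_cat A C) ((?E, c), e, fst l) l r"
  proof (rule coalg.equalizerI)
    fix h assume h: "h \<in> Arr (coalg_cat A C)" "Cod (coalg_cat A C) h = Dom (coalg_cat A C) l"
      "l \<cdot>\<^bsub>coalg_cat A C\<^esub> h = r \<cdot>\<^bsub>coalg_cat A C\<^esub> h"
    obtain k where k: "k \<in> Arr A" "Dom A k = fst (fst h)" "Cod A k = ?E"
      and ek: "e \<cdot>\<^bsub>A\<^esub> k = und h"
      using F.A.equalizer_factor[OF e, of "und h"] h l by auto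
    have "amap (fn C) e \<cdot>\<^bsub>A\<^esub> (c \<cdot>\<^bsub>A\<^esub> k) = ?a \<cdot>\<^bsub>A\<^esub> (e \<cdot>\<^bsub>A\<^esub> k)"
      using F.A.comp_eq_extend[OF Ce_c, of k] c k d(5) e_cod X by simp
    also have "\<dots> = amap (fn C) (und h) \<cdot>\<^bsub>A\<^esub> snd (fst h)"
      using coalg_arr_law[OF h(1)] h(2) ek by simp
    also have "\<dots> = amap (fn C) e \<cdot>\<^bsub>A\<^esub> (amap (fn C) k \<cdot>\<^bsub>A\<^esub> snd (fst h))"
      using h(1) k d(5) by (simp flip: ek add: F.map_comp)
    finally have "amap (fn C) e \<cdot>\<^bsub>A\<^esub> (c \<cdot>\<^bsub>A\<^esub> k)
        = amap (fn C) e \<cdot>\<^bsub>A\<^esub> (amap (fn C) k \<cdot>\<^bsub>A\<^esub> snd (fst h))" .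
    then have "c \<cdot>\<^bsub>A\<^esub> k = amap (fn C) k \<cdot>\<^bsub>A\<^esub> snd (fst h)"
      using c k d(5) h(1) by - (rule F.A.equalizer_mono[OF Ce], simp_all)
    then have "(fst h, k, (?E, c)) \<in> Arr (coalg_cat A C)"
      using E h(1) k by (simp add: coalg_triple_iff)
    then show "\<exists>k. k \<in> Arr (coalg_cat A C) \<and> Dom (coalg_cat A C) k = Dom (coalg_cat A C) h \<and>
        Cod (coalg_cat A C) k = Dom (coalg_cat A C) ((?E, c), e, fst l) \<and>
        ((?E, c), e, fst l) \<cdot>\<^bsub>coalg_cat A C\<^esub> k = h"
      using ek h(2) by (intro exI[of _ "(fst h, k, (?E, c))"]) (simp add: prod_eq_iff)
  next
    fix k k' assume k: "k \<in> Arr (coalg_cat A C)" "k' \<in> Arr (coalg_cat A C)"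
      "Dom (coalg_cat A C) k' = Dom (coalg_cat A C) k"
      "Cod (coalg_cat A C) k = Dom (coalg_cat A C) ((?E, c), e, fst l)"
      "Cod (coalg_cat A C) k' = Dom (coalg_cat A C) ((?E, c), e, fst l)"
      "((?E, c), e, fst l) \<cdot>\<^bsub>coalg_cat A C\<^esub> k = ((?E, c), e, fst l) \<cdot>\<^bsub>coalg_cat A C\<^esub> k'"
    have "und k = und k'"
      by (rule F.A.equalizer_mono[OF e]) (use k in simp_all)
    then show "k = k'"
      using k by (simp add: prod_eq_iff)
  qed (use l r par e_arr d(7) in simp_all)
  then show thesis
    by (rule that)
qed

text \<open>Up to an isomorphism of coalgebras \<open>k\<close> is the lift of \<open>e\<close>.\<close>

lemma coalg_equalizer_und:
  assumes "l \<in> Arr (coalg_cat A C)" "r \<in> Arr (coalg_cat A C)"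
    "fst r = fst l" "snd (snd r) = snd (snd l)"
    and e: "is_equalizer A e (und l) (und r)"
    and "is_equalizer A (amap (fn C) e) (amap (fn C) (und l)) (amap (fn C) (und r))"
    "is_equalizer A (amap (fn C \<circ>\<^sub>F fn C) e) (amap (fn C \<circ>\<^sub>F fn C) (und l))
      (amap (fn C \<circ>\<^sub>F fn C) (und r))"
    and k: "is_equalizer (coalg_cat A C) k l r"
  shows "is_equalizer A (und k) (und l) (und r)"
proof -
  obtain c where e': "is_equalizer (coalg_cat A C) ((Dom A e, c), e, fst l) l r"
    using coalg_equalizer_lift[OF assms(1-7)] .
  obtain u where iso: "iso (coalg_cat A C) u"
    and "Dom (coalg_cat A C) u = Dom (coalg_cat A C) k"
    and cod: "Cod (coalg_cat A C) u = Dom (coalg_cat A C) ((Dom A e, c), e, fst l)"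
    and comp: "((Dom A e, c), e, fst l) \<cdot>\<^bsub>coalg_cat A C\<^esub> u = k"
    by (rule coalg.equalizers_iso[OF e' k])
  have u: "u \<in> Arr (coalg_cat A C)"
    using iso by (simp add: iso_def)
  have "und k = e \<cdot>\<^bsub>A\<^esub> und u"
    using comp by auto
  then show ?thesis
    using F.A.equalizer_precomp_iso[OF e, of "und u"] iso_coalg_iff[OF u] iso cod u by simp
qed

end

section \<open>The functor induced by a colax morphism of comonads\<close>

lemma H_sigma_sel [simp]:
  "fst (H_sigma_obj B H \<sigma> x) = omap H (fst x)"
  "snd (H_sigma_obj B H \<sigma> x) = \<sigma> (fst x) \<cdot>\<^bsub>B\<^esub> amap H (snd x)"
  "omap (H_sigma B H \<sigma>) x = H_sigma_obj B H \<sigma> x"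
  "amap (H_sigma B H \<sigma>) k = (H_sigma_obj B H \<sigma> (fst k), amap H (und k), H_sigma_obj B H \<sigma> (snd (snd k)))"
  by (simp_all add: H_sigma_obj_def H_sigma_def case_prod_beta)

context colax_comonad_morphism
begin

sublocale H: cat_functor A B H
  by (rule functor_H)

lemma sigma_natural:
  assumes "f \<in> Arr A"
  shows "\<sigma> (Cod A f) \<cdot>\<^bsub>B\<^esub> amap H (amap (fn C) f) = amap (fn D) (amap H f) \<cdot>\<^bsub>B\<^esub> \<sigma> (Dom A f)"
  using natural[OF assms] by simp

text \<open>The two laws of the coalgebra \<open>(H X, \<sigma>\<^sub>X \<circ> H c)\<close> are the \<open>H\<close>-images of those of \<open>(X, c)\<close>,
  translated by the two axioms of a colax morphism.\<close>

lemma H_sigma_coalgebra [simp]: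
  assumes x: "x \<in> coalgebras A C"
  shows "H_sigma_obj B H \<sigma> x \<in> coalgebras B D"
proof -
  let ?X = "fst x" and ?c = "snd x"
  note X = C.coalgebraD[OF x]
  have "\<delta>\<^bsub>D\<^esub> (omap H ?X) \<cdot>\<^bsub>B\<^esub> (\<sigma> ?X \<cdot>\<^bsub>B\<^esub> amap H ?c)
      = amap (fn D) (\<sigma> ?X) \<cdot>\<^bsub>B\<^esub> (\<sigma> (omap (fn C) ?X) \<cdot>\<^bsub>B\<^esub> amap H (\<delta>\<^bsub>C\<^esub> ?X \<cdot>\<^bsub>A\<^esub> ?c))"
    using D.F.A.comp_eq_extend[OF colax_comult[OF X(1)], of "amap H ?c"] X by (simp add: H.map_comp)
  also have "\<dots> = amap (fn D) (\<sigma> ?X) \<cdot>\<^bsub>B\<^esub>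
      ((\<sigma> (omap (fn C) ?X) \<cdot>\<^bsub>B\<^esub> amap H (amap (fn C) ?c)) \<cdot>\<^bsub>B\<^esub> amap H ?c)"
    using X by (simp add: C.coalgebra_laws[OF x] H.map_comp)
  also have "\<dots> = amap (fn D) (\<sigma> ?X \<cdot>\<^bsub>B\<^esub> amap H ?c) \<cdot>\<^bsub>B\<^esub> (\<sigma> ?X \<cdot>\<^bsub>B\<^esub> amap H ?c)"
    using X sigma_natural[OF X(2)] by (simp add: D.F.map_comp)
  finally have comult: "\<delta>\<^bsub>D\<^esub> (omap H ?X) \<cdot>\<^bsub>B\<^esub> (\<sigma> ?X \<cdot>\<^bsub>B\<^esub> amap H ?c)
      = amap (fn D) (\<sigma> ?X \<cdot>\<^bsub>B\<^esub> amap H ?c) \<cdot>\<^bsub>B\<^esub> (\<sigma> ?X \<cdot>\<^bsub>B\<^esub> amap H ?c)" .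
  have "\<epsilon>\<^bsub>D\<^esub> (omap H ?X) \<cdot>\<^bsub>B\<^esub> (\<sigma> ?X \<cdot>\<^bsub>B\<^esub> amap H ?c) = amap H (\<epsilon>\<^bsub>C\<^esub> ?X \<cdot>\<^bsub>A\<^esub> ?c)"
    using D.F.A.comp_eq_extend[OF colax_counit[OF X(1)], of "amap H ?c"] X by (simp add: H.map_comp)
  also have "\<dots> = Id B (omap H ?X)"
    using X by (simp add: C.coalgebra_laws[OF x])
  finally show ?thesis
    unfolding D.coalgebra_iff using comult X by simp
qed

lemma H_sigma_arr:
  assumes k: "k \<in> Arr (coalg_cat A C)"
  shows "(H_sigma_obj B H \<sigma> (fst k), amap H (und k), H_sigma_obj B H \<sigma> (snd (snd k)))
    \<in> Arr (coalg_cat B D)"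
proof -
  let ?x = "fst k" and ?y = "snd (snd k)"
  have "(\<sigma> (fst ?y) \<cdot>\<^bsub>B\<^esub> amap H (snd ?y)) \<cdot>\<^bsub>B\<^esub> amap H (und k)
      = \<sigma> (fst ?y) \<cdot>\<^bsub>B\<^esub> amap H (snd ?y \<cdot>\<^bsub>A\<^esub> und k)"
    using k by (simp add: H.map_comp)
  also have "\<dots> = (\<sigma> (fst ?y) \<cdot>\<^bsub>B\<^esub> amap H (amap (fn C) (und k))) \<cdot>\<^bsub>B\<^esub> amap H (snd ?x)"
    using k by (simp add: C.coalg_arr_law H.map_comp)
  also have "\<dots> = amap (fn D) (amap H (und k)) \<cdot>\<^bsub>B\<^esub> (\<sigma> (fst ?x) \<cdot>\<^bsub>B\<^esub> amap H (snd ?x))"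
    using k sigma_natural[of "und k"] by simp
  finally show ?thesis
    using k by (simp add: D.coalg_triple_iff)
qed

lemma H_sigma_functor: "cat_functor (coalg_cat A C) (coalg_cat B D) (H_sigma B H \<sigma>)"
  by unfold_locales (simp_all add: hom_iff H.map_comp H_sigma_arr)

end

section \<open>Transposition along the composite adjunction\<close>

lemma fn_conjugate [simp]: "fn (conjugate_comonad N C H K \<eta> \<xi>) = H \<circ>\<^sub>F fn C \<circ>\<^sub>F K"
  by (simp add: conjugate_comonad_def)

lemma K_tau_pair_sel [simp]:
  "fst (K_tau_left M C D K \<tau> y) = cofree C (omap K (fst y))"
  "und (K_tau_left M C D K \<tau> y) = amap (fn C) (\<tau> (fst y)) \<cdot>\<^bsub>M\<^esub> \<delta>\<^bsub>C\<^esub> (omap K (fst y))"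
  "snd (snd (K_tau_left M C D K \<tau> y)) = cofree C (omap K (omap (fn D) (fst y)))"
  "fst (K_tau_right C D K y) = cofree C (omap K (fst y))"
  "und (K_tau_right C D K y) = amap (fn C) (amap K (snd y))"
  "snd (snd (K_tau_right C D K y)) = cofree C (omap K (omap (fn D) (fst y)))"
  by (simp_all add: K_tau_left_def K_tau_right_def case_prod_beta)

locale colax_adjunction =
  adj: adjunction M N H K \<eta> \<xi> + colax: colax_comonad_morphism M C N D H \<sigma>
  for M :: "('o, 'a) cat" and N :: "('p, 'b) cat"
    and H :: "('o, 'a, 'p, 'b) func" and K :: "('p, 'b, 'o, 'a) func"
    and \<eta> :: "'o \<Rightarrow> 'a" and \<xi> :: "'p \<Rightarrow> 'b"
    and C :: "('o, 'a) comonad_data" and D :: "('p, 'b) comonad_data"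
    and \<sigma> :: "'o \<Rightarrow> 'b"
begin

abbreviation \<tau> :: "'p \<Rightarrow> 'a" where
  "\<tau> \<equiv> mate M C D K \<eta> \<xi> \<sigma>"

abbreviation \<sigma>' :: "'p \<Rightarrow> 'b" where
  "\<sigma>' \<equiv> conjugate_trans N D K \<xi> \<sigma>"

abbreviation Left :: "('p, 'b) coalg \<Rightarrow> ('o, 'a) coalg_mor" where
  "Left \<equiv> K_tau_left M C D K \<tau>"

abbreviation Right :: "('p, 'b) coalg \<Rightarrow> ('o, 'a) coalg_mor" where
  "Right \<equiv> K_tau_right C D K"

abbreviation H\<^sub>\<sigma> :: "('o, 'a) coalg \<Rightarrow> ('p, 'b) coalg" where
  "H\<^sub>\<sigma> \<equiv> H_sigma_obj N H \<sigma>"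

sublocale conj: nat_trans N N "fn (conjugate_comonad N C H K \<eta> \<xi>)" "fn D" \<sigma>'
  by (rule conjugate_trans_universal(1)[OF adj.adjunction_axioms colax.C.F.cat_functor_axioms
      colax.D.F.cat_functor_axioms colax.nat_trans_axioms])

sublocale H\<sigma>: cat_functor "coalg_cat M C" "coalg_cat N D" "H_sigma N H \<sigma>"
  by (rule colax.H_sigma_functor)

lemma unit_natural:
  assumes "f \<in> Arr M"
  shows "\<eta> (Cod M f) \<cdot>\<^bsub>M\<^esub> f = amap K (amap H f) \<cdot>\<^bsub>M\<^esub> \<eta> (Dom M f)"
  using adj.unit.natural[OF assms] by simp

lemma counit_natural:
  assumes "g \<in> Arr N"
  shows "\<xi> (Cod N g) \<cdot>\<^bsub>N\<^esub> amap H (amap K g) = g \<cdot>\<^bsub>N\<^esub> \<xi> (Dom N g)"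
  using adj.counit.natural[OF assms] by simp

text \<open>This lemma and the next one are the two halves of the bijection between arrows \<open>H X \<rightarrow> Y\<close> and
  arrows \<open>X \<rightarrow> K Y\<close>.\<close>

lemma transpose_right:
  assumes "f \<in> Arr N" "X \<in> Obj M" "Dom N f = omap H X" "Cod N f = Y"
  shows "\<xi> Y \<cdot>\<^bsub>N\<^esub> amap H (amap K f \<cdot>\<^bsub>M\<^esub> \<eta> X) = f"
proof -
  have "Y \<in> Obj N"
    using assms adj.F.B.cod_obj by blast
  then show ?thesis
    using assms adj.F.B.comp_eq_extend[OF counit_natural[of f]]
    by (simp add: adj.F.map_comp adj.triangle_left)
qed

lemma transpose_left:
  assumes "u \<in> Arr M" "Y \<in> Obj N" "Dom M u = X" "Cod M u = omap K Y"
  shows "amap K (\<xi> Y \<cdot>\<^bsub>N\<^esub> amap H u) \<cdot>\<^bsub>M\<^esub> \<eta> X = u"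
proof -
  have "X \<in> Obj M"
    using assms adj.F.A.dom_obj by blast
  moreover have "amap K (amap H u) \<cdot>\<^bsub>M\<^esub> \<eta> X = \<eta> (omap K Y) \<cdot>\<^bsub>M\<^esub> u"
    using assms unit_natural[of u] by simp
  ultimately show ?thesis
    using assms adj.F.A.comp_eq_extend[OF adj.triangle_right[of Y]] by (simp add: adj.G.map_comp)
qed

lemma conj_def: "\<sigma>' Y = amap (fn D) (\<xi> Y) \<cdot>\<^bsub>N\<^esub> \<sigma> (omap K Y)"
  by (simp add: conjugate_trans_def)

text \<open>The mate \<open>\<tau>\<^sub>Y\<close> is the transpose of \<open>\<sigma>'\<^sub>Y\<close>. All facts about \<open>\<tau>\<close> below are read off from \<open>\<sigma>'\<close>
  through this.\<close>

lemma mate_eq: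
  assumes "Y \<in> Obj N"
  shows "\<tau> Y = amap K (\<sigma>' Y) \<cdot>\<^bsub>M\<^esub> \<eta> (omap (fn C) (omap K Y))"
  using assms by (simp add: mate_def conj_def adj.G.map_comp)

lemma mate_arr [simp]:
  assumes "Y \<in> Obj N"
  shows "\<tau> Y \<in> Arr M" "Dom M (\<tau> Y) = omap (fn C) (omap K Y)"
    "Cod M (\<tau> Y) = omap K (omap (fn D) Y)"
  using assms by (simp_all add: mate_eq)

lemma counit_mate:
  assumes "Y \<in> Obj N"
  shows "\<xi> (omap (fn D) Y) \<cdot>\<^bsub>N\<^esub> amap H (\<tau> Y) = \<sigma>' Y"
  using assms by (simp add: mate_eq transpose_right)

lemma conj_comp_map:
  assumes f: "f \<in> Arr M" "Dom M f = X" "Cod M f = omap K Y" and Y: "Y \<in> Obj N"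
  shows "\<sigma>' Y \<cdot>\<^bsub>N\<^esub> amap H (amap (fn C) f) = amap (fn D) (\<xi> Y \<cdot>\<^bsub>N\<^esub> amap H f) \<cdot>\<^bsub>N\<^esub> \<sigma> X"
proof -
  have "X \<in> Obj M"
    using f adj.F.A.dom_obj by blast
  then show ?thesis
    using f Y colax.sigma_natural[of f] by (simp add: conj_def colax.D.F.map_comp)
qed

text \<open>In other words, \<open>\<sigma>'\<^sub>Y\<close> is a morphism of \<open>D\<close>-coalgebras from \<open>H\<^sub>\<sigma>\<close> of the cofree coalgebra on
  \<open>K Y\<close> to the cofree coalgebra on \<open>Y\<close>.\<close>

lemma conj_comult:
  assumes Y: "Y \<in> Obj N"
  shows "\<delta>\<^bsub>D\<^esub> Y \<cdot>\<^bsub>N\<^esub> \<sigma>' Y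
    = amap (fn D) (\<sigma>' Y) \<cdot>\<^bsub>N\<^esub> (\<sigma> (omap (fn C) (omap K Y)) \<cdot>\<^bsub>N\<^esub> amap H (\<delta>\<^bsub>C\<^esub> (omap K Y)))"
proof -
  let ?X = "omap K Y"
  have X: "?X \<in> Obj M"
    using Y by simp
  have "\<delta>\<^bsub>D\<^esub> Y \<cdot>\<^bsub>N\<^esub> \<sigma>' Y
      = amap (fn D) (amap (fn D) (\<xi> Y)) \<cdot>\<^bsub>N\<^esub> (\<delta>\<^bsub>D\<^esub> (omap H ?X) \<cdot>\<^bsub>N\<^esub> \<sigma> ?X)"
    using X Y adj.F.B.comp_eq_extend[OF colax.D.comult_natural[of "\<xi> Y"]] by (simp add: conj_def)
  also have "\<dots> = amap (fn D) (\<sigma>' Y) \<cdot>\<^bsub>N\<^esub> (\<sigma> (omap (fn C) ?X) \<cdot>\<^bsub>N\<^esub> amap H (\<delta>\<^bsub>C\<^esub> ?X))"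
    using X Y by (simp add: colax.colax_comult conj_def colax.D.F.map_comp)
  finally show ?thesis .
qed

lemma conj_counit:
  assumes Y: "Y \<in> Obj N"
  shows "\<epsilon>\<^bsub>D\<^esub> Y \<cdot>\<^bsub>N\<^esub> \<sigma>' Y = \<xi> Y \<cdot>\<^bsub>N\<^esub> amap H (\<epsilon>\<^bsub>C\<^esub> (omap K Y))"
proof -
  have "\<epsilon>\<^bsub>D\<^esub> Y \<cdot>\<^bsub>N\<^esub> \<sigma>' Y = \<xi> Y \<cdot>\<^bsub>N\<^esub> (\<epsilon>\<^bsub>D\<^esub> (omap H (omap K Y)) \<cdot>\<^bsub>N\<^esub> \<sigma> (omap K Y))"
    using Y adj.F.B.comp_eq_extend[OF colax.D.counit_natural[of "\<xi> Y"]] by (simp add: conj_def)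
  then show ?thesis
    using Y by (simp add: colax.colax_counit)
qed

text \<open>Under \<open>\<sigma>'\<close> the \<open>H\<close>-image of the first arrow of the pair that defines \<open>K\<^sup>\<tau>\<close> becomes the
  comultiplication of \<open>D\<close>. The second one becomes \<open>D d\<close> by naturality of \<open>\<sigma>'\<close>.\<close>

lemma conj_comp_left:
  assumes Y: "Y \<in> Obj N"
  shows "\<sigma>' (omap (fn D) Y) \<cdot>\<^bsub>N\<^esub> amap H (amap (fn C) (\<tau> Y) \<cdot>\<^bsub>M\<^esub> \<delta>\<^bsub>C\<^esub> (omap K Y))
    = \<delta>\<^bsub>D\<^esub> Y \<cdot>\<^bsub>N\<^esub> \<sigma>' Y"
  using Y adj.F.B.comp_eq_extend[OF conj_comp_map[of "\<tau> Y"]]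
  by (simp add: conj_comult counit_mate adj.F.map_comp)

lemma counit_comp_mate:
  assumes Y: "Y \<in> Obj N"
  shows "amap K (\<epsilon>\<^bsub>D\<^esub> Y) \<cdot>\<^bsub>M\<^esub> \<tau> Y = \<epsilon>\<^bsub>C\<^esub> (omap K Y)"
proof -
  have "amap K (\<epsilon>\<^bsub>D\<^esub> Y) \<cdot>\<^bsub>M\<^esub> \<tau> Y = amap K (\<epsilon>\<^bsub>D\<^esub> Y \<cdot>\<^bsub>N\<^esub> \<sigma>' Y) \<cdot>\<^bsub>M\<^esub> \<eta> (omap (fn C) (omap K Y))"
    using Y by (simp add: mate_eq adj.G.map_comp)
  also have "\<dots> = \<epsilon>\<^bsub>C\<^esub> (omap K Y)"
    using Y unfolding conj_counit[OF Y] by (intro transpose_left) simp_all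
  finally show ?thesis .
qed

text \<open>The transpose of a coalgebra morphism \<open>k\<close> into the cofree coalgebra on \<open>K Y\<close> under the
  composite of the cofree adjunction with the one between \<open>H\<close> and \<open>K\<close>.\<close>

definition adjunct :: "'p \<Rightarrow> ('o, 'a) coalg_mor \<Rightarrow> 'b" where
  "adjunct Y k = \<xi> Y \<cdot>\<^bsub>N\<^esub> amap H (\<epsilon>\<^bsub>C\<^esub> (omap K Y) \<cdot>\<^bsub>M\<^esub> und k)"

lemma adjunct_arr [simp]:
  assumes "k \<in> Arr (coalg_cat M C)" "snd (snd k) = cofree C (omap K Y)" "Y \<in> Obj N"
  shows "adjunct Y k \<in> Arr N" "Dom N (adjunct Y k) = omap H (fst (fst k))" "Cod N (adjunct Y k) = Y"
  using assms by (simp_all add: adjunct_def)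

lemma adjunct_surj:
  assumes f: "f \<in> Arr N" "Dom N f = omap H (fst x)" "Cod N f = Y" and x: "x \<in> coalgebras M C"
  defines "k \<equiv> (x, amap (fn C) (amap K f \<cdot>\<^bsub>M\<^esub> \<eta> (fst x)) \<cdot>\<^bsub>M\<^esub> snd x, cofree C (omap K Y))"
  shows "k \<in> Arr (coalg_cat M C)" "adjunct Y k = f"
proof -
  have Y: "Y \<in> Obj N"
    using f adj.F.B.cod_obj by blast
  show "k \<in> Arr (coalg_cat M C)"
    unfolding k_def using f x Y by (intro colax.C.transpose_coalg_arr) simp_all
  have "\<epsilon>\<^bsub>C\<^esub> (omap K Y) \<cdot>\<^bsub>M\<^esub> und k = amap K f \<cdot>\<^bsub>M\<^esub> \<eta> (fst x)"
    unfolding k_def fst_conv snd_conv using f x Y by (intro colax.C.counit_transpose) simp_all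
  then show "adjunct Y k = f"
    using f x by (simp add: adjunct_def transpose_right)
qed

lemma adjunct_inj:
  assumes k: "k \<in> Arr (coalg_cat M C)" "snd (snd k) = cofree C (omap K Y)"
    and k': "k' \<in> Arr (coalg_cat M C)" "snd (snd k') = cofree C (omap K Y)" "fst k' = fst k"
    and Y: "Y \<in> Obj N" and same: "adjunct Y k = adjunct Y k'"
  shows "k = k'"
proof -
  have "\<epsilon>\<^bsub>C\<^esub> (omap K Y) \<cdot>\<^bsub>M\<^esub> und h = amap K (adjunct Y h) \<cdot>\<^bsub>M\<^esub> \<eta> (fst (fst k))"
    if "h \<in> Arr (coalg_cat M C)" "snd (snd h) = cofree C (omap K Y)" "fst h = fst k" for h
    unfolding adjunct_def using that Y by (intro transpose_left[symmetric]) simp_all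
  then have "\<epsilon>\<^bsub>C\<^esub> (omap K Y) \<cdot>\<^bsub>M\<^esub> und k = \<epsilon>\<^bsub>C\<^esub> (omap K Y) \<cdot>\<^bsub>M\<^esub> und k'"
    using k k' same by simp
  then have "und k = und k'"
    using colax.C.transpose_counit[OF k] colax.C.transpose_counit[OF k'(1,2)] k' Y by simp
  then show ?thesis
    using k k' by (simp add: prod_eq_iff)
qed

lemma adjunct_comp:
  assumes "j \<in> Arr (coalg_cat M C)" "k \<in> Arr (coalg_cat M C)" "snd (snd j) = fst k"
    "snd (snd k) = cofree C (omap K Y)" "Y \<in> Obj N"
  shows "adjunct Y (k \<cdot>\<^bsub>coalg_cat M C\<^esub> j) = adjunct Y k \<cdot>\<^bsub>N\<^esub> amap H (und j)"
  using assms by (simp add: adjunct_def adj.F.map_comp)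

lemma adjunct_map:
  assumes k: "k \<in> Arr (coalg_cat M C)" "snd (snd k) = cofree C (omap K Y)"
    and g: "g \<in> Arr N" "Dom N g = Y" "Cod N g = Z"
  shows "adjunct Z (x, amap (fn C) (amap K g) \<cdot>\<^bsub>M\<^esub> und k, z) = g \<cdot>\<^bsub>N\<^esub> adjunct Y k"
proof -
  have YZ: "Y \<in> Obj N" "Z \<in> Obj N"
    using g adj.F.B.dom_obj adj.F.B.cod_obj by blast+
  have "\<epsilon>\<^bsub>C\<^esub> (omap K Z) \<cdot>\<^bsub>M\<^esub> (amap (fn C) (amap K g) \<cdot>\<^bsub>M\<^esub> und k)
      = amap K g \<cdot>\<^bsub>M\<^esub> (\<epsilon>\<^bsub>C\<^esub> (omap K Y) \<cdot>\<^bsub>M\<^esub> und k)"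
    using adj.F.A.comp_eq_extend[OF colax.C.counit_natural[of "amap K g"], of "und k"] k g YZ by simp
  then show ?thesis
    using adj.F.B.comp_eq_extend[OF counit_natural[of g]] k g YZ
    by (simp add: adjunct_def adj.F.map_comp)
qed

text \<open>The counit of \<open>C\<close> moves past \<open>C \<tau>\<^sub>Y\<close> by naturality and cancels the comultiplication, so the
  adjunct is \<open>\<xi> \<circ> H \<tau>\<^sub>Y \<circ> H k = \<sigma>'\<^sub>Y \<circ> H k\<close>. Writing \<open>k\<close> as the cofree extension of \<open>\<epsilon> \<circ> k\<close> and using naturality of \<open>\<sigma>\<close> brings out \<open>D\<close> of the
  adjunct.\<close>

lemma adjunct_left:
  assumes k: "k \<in> Arr (coalg_cat M C)" "snd (snd k) = cofree C (omap K (fst y))"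
    and y: "y \<in> coalgebras N D"
  shows "adjunct (omap (fn D) (fst y)) (Left y \<cdot>\<^bsub>coalg_cat M C\<^esub> k)
    = amap (fn D) (adjunct (fst y) k) \<cdot>\<^bsub>N\<^esub> snd (H\<^sub>\<sigma> (fst k))"
proof -
  let ?Y = "fst y" and ?X = "fst (fst k)"
  let ?u = "\<epsilon>\<^bsub>C\<^esub> (omap K ?Y) \<cdot>\<^bsub>M\<^esub> und k"
  have Y: "?Y \<in> Obj N"
    using y by simp
  have "\<epsilon>\<^bsub>C\<^esub> (omap K (omap (fn D) ?Y)) \<cdot>\<^bsub>M\<^esub> (amap (fn C) (\<tau> ?Y) \<cdot>\<^bsub>M\<^esub> (\<delta>\<^bsub>C\<^esub> (omap K ?Y) \<cdot>\<^bsub>M\<^esub> und k))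
      = \<tau> ?Y \<cdot>\<^bsub>M\<^esub> und k"
    using k Y adj.F.A.comp_eq_extend[OF colax.C.counit_natural[of "\<tau> ?Y"]]
      adj.F.A.comp_eq_extend[OF colax.C.counit_left[of "omap K ?Y"]] by simp
  then have "adjunct (omap (fn D) ?Y) (Left y \<cdot>\<^bsub>coalg_cat M C\<^esub> k)
      = \<xi> (omap (fn D) ?Y) \<cdot>\<^bsub>N\<^esub> amap H (\<tau> ?Y \<cdot>\<^bsub>M\<^esub> und k)"
    using k Y by (simp add: adjunct_def)
  also have "\<dots> = \<sigma>' ?Y \<cdot>\<^bsub>N\<^esub> amap H (und k)"
    using k Y adj.F.B.comp_eq_extend[OF counit_mate[OF Y]] by (simp add: adj.F.map_comp)
  also have "\<dots> = \<sigma>' ?Y \<cdot>\<^bsub>N\<^esub> (amap H (amap (fn C) ?u) \<cdot>\<^bsub>N\<^esub> amap H (snd (fst k)))"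
    using k Y colax.C.transpose_counit[OF k] by (simp flip: adj.F.map_comp)
  also have "\<dots> = amap (fn D) (adjunct ?Y k) \<cdot>\<^bsub>N\<^esub> (\<sigma> ?X \<cdot>\<^bsub>N\<^esub> amap H (snd (fst k)))"
    using k Y adj.F.B.comp_eq_extend[OF conj_comp_map[of ?u ?X]] by (simp add: adjunct_def)
  finally show ?thesis
    by simp
qed

lemma adjunct_right:
  assumes k: "k \<in> Arr (coalg_cat M C)" "snd (snd k) = cofree C (omap K (fst y))"
    and y: "y \<in> coalgebras N D"
  shows "adjunct (omap (fn D) (fst y)) (Right y \<cdot>\<^bsub>coalg_cat M C\<^esub> k) = snd y \<cdot>\<^bsub>N\<^esub> adjunct (fst y) k"
  using k y by (simp add: adjunct_map)

lemma left_arr [simp]: "y \<in> coalgebras N D \<Longrightarrow> Left y \<in> Arr (coalg_cat M C)"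
  using colax.C.transpose_coalg_arr[of "cofree C (omap K (fst y))" "\<tau> (fst y)"]
  by (simp add: K_tau_left_def case_prod_beta)

lemma right_arr [simp]: "y \<in> coalgebras N D \<Longrightarrow> Right y \<in> Arr (coalg_cat M C)"
  using colax.C.cofree_map[of "amap K (snd y)"]
  by (simp add: K_tau_right_def case_prod_beta)

text \<open>By injectivity of adjuncts, equalizing the pair means that the two adjuncts computed above
  agree, which is the defining square of a morphism of \<open>D\<close>-coalgebras.\<close>

lemma equalizes_iff_coalg_arr:
  assumes k: "k \<in> Arr (coalg_cat M C)" "snd (snd k) = cofree C (omap K (fst y))"
    and y: "y \<in> coalgebras N D"
  shows "Left y \<cdot>\<^bsub>coalg_cat M C\<^esub> k = Right y \<cdot>\<^bsub>coalg_cat M C\<^esub> k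
    \<longleftrightarrow> (H\<^sub>\<sigma> (fst k), adjunct (fst y) k, y) \<in> Arr (coalg_cat N D)"
proof -
  let ?Y = "omap (fn D) (fst y)"
  have "Left y \<cdot>\<^bsub>coalg_cat M C\<^esub> k = Right y \<cdot>\<^bsub>coalg_cat M C\<^esub> k
      \<longleftrightarrow> adjunct ?Y (Left y \<cdot>\<^bsub>coalg_cat M C\<^esub> k) = adjunct ?Y (Right y \<cdot>\<^bsub>coalg_cat M C\<^esub> k)"
  proof
    assume "adjunct ?Y (Left y \<cdot>\<^bsub>coalg_cat M C\<^esub> k) = adjunct ?Y (Right y \<cdot>\<^bsub>coalg_cat M C\<^esub> k)"
    then show "Left y \<cdot>\<^bsub>coalg_cat M C\<^esub> k = Right y \<cdot>\<^bsub>coalg_cat M C\<^esub> k"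
      using colax.C.coalg.comp_arr(1)[OF k(1) left_arr[OF y]]
        colax.C.coalg.comp_arr(1)[OF k(1) right_arr[OF y]] k y
      by - (rule adjunct_inj[of _ ?Y], simp_all)
  qed simp
  also have "\<dots> \<longleftrightarrow> (H\<^sub>\<sigma> (fst k), adjunct (fst y) k, y) \<in> Arr (coalg_cat N D)"
    unfolding adjunct_left[OF k y] adjunct_right[OF k y] colax.D.coalg_triple_iff
    using k y by auto
  finally show ?thesis .
qed

section \<open>The adjunction between coalgebra categories\<close>

text \<open>Factorisations of \<open>h\<close> through \<open>e\<close> are the same as factorisations of the adjunct of \<open>h\<close>
  through the adjunct of \<open>e\<close>; this turns the universal property of an equalizer into that of a
  universal arrow.\<close>

lemma factor_iff:
  assumes e: "e \<in> Arr (coalg_cat M C)" "snd (snd e) = cofree C (omap K (fst y))"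
    and y: "y \<in> coalgebras N D"
    and k: "k \<in> Arr (coalg_cat M C)" "snd (snd k) = fst e"
    and h: "h \<in> Arr (coalg_cat M C)" "fst h = fst k" "snd (snd h) = cofree C (omap K (fst y))"
  shows "e \<cdot>\<^bsub>coalg_cat M C\<^esub> k = h
    \<longleftrightarrow> (H\<^sub>\<sigma> (fst e), adjunct (fst y) e, y) \<cdot>\<^bsub>coalg_cat N D\<^esub> amap (H_sigma N H \<sigma>) k
      = (H\<^sub>\<sigma> (fst k), adjunct (fst y) h, y)"
proof -
  have "e \<cdot>\<^bsub>coalg_cat M C\<^esub> k = h \<longleftrightarrow> adjunct (fst y) (e \<cdot>\<^bsub>coalg_cat M C\<^esub> k) = adjunct (fst y) h"
  proof
    assume "adjunct (fst y) (e \<cdot>\<^bsub>coalg_cat M C\<^esub> k) = adjunct (fst y) h"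
    then show "e \<cdot>\<^bsub>coalg_cat M C\<^esub> k = h"
      using colax.C.coalg.comp_arr(1)[OF k(1) e(1)] e k h y
      by - (rule adjunct_inj[of _ "fst y"], simp_all)
  qed simp
  then show ?thesis
    using adjunct_comp[OF k(1) e(1) k(2) e(2)] y by simp
qed

lemma equalizer_universal_arrow:
  assumes y: "y \<in> coalgebras N D" and e: "is_equalizer (coalg_cat M C) e (Left y) (Right y)"
  shows "universal_arrow (coalg_cat M C) (coalg_cat N D) (H_sigma N H \<sigma>) (fst e) y
    (H\<^sub>\<sigma> (fst e), adjunct (fst y) e, y)"
proof -
  note d = colax.C.coalg.equalizerD[OF e]
  have e_arr: "e \<in> Arr (coalg_cat M C)" "snd (snd e) = cofree C (omap K (fst y))"
    using d by simp_all
  have p: "(H\<^sub>\<sigma> (fst e), adjunct (fst y) e, y) \<in> Arr (coalg_cat N D)"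
    using equalizes_iff_coalg_arr[OF e_arr y] d(7) by blast
  have "\<exists>!k. k \<in> hom (coalg_cat M C) w (fst e) \<and>
      (H\<^sub>\<sigma> (fst e), adjunct (fst y) e, y) \<cdot>\<^bsub>coalg_cat N D\<^esub> amap (H_sigma N H \<sigma>) k = f"
    if w: "w \<in> coalgebras M C" and f: "f \<in> hom (coalg_cat N D) (H\<^sub>\<sigma> w) y" for w f
  proof -
    have f_arr: "f \<in> Arr (coalg_cat N D)" "fst f = H\<^sub>\<sigma> w" "snd (snd f) = y"
      using f by (simp_all add: hom_iff)
    have f_eq: "f = (H\<^sub>\<sigma> w, und f, y)"
      using f_arr by (simp add: prod_eq_iff)
    have f_und: "und f \<in> Arr N" "Dom N (und f) = omap H (fst w)" "Cod N (und f) = fst y"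
      using colax.D.coalg_arrD[OF f_arr(1)] f_arr by simp_all
    obtain h where h: "h \<in> Arr (coalg_cat M C)" "fst h = w" "snd (snd h) = cofree C (omap K (fst y))"
      and adj_h: "adjunct (fst y) h = und f"
      using adjunct_surj[OF f_und w] by fastforce
    have "Left y \<cdot>\<^bsub>coalg_cat M C\<^esub> h = Right y \<cdot>\<^bsub>coalg_cat M C\<^esub> h"
      using equalizes_iff_coalg_arr[OF h(1,3) y] h(2) adj_h f_arr(1) f_eq by metis
    then have "\<exists>!k. k \<in> hom (coalg_cat M C) w (fst e) \<and> e \<cdot>\<^bsub>coalg_cat M C\<^esub> k = h"
      using colax.C.coalg.equalizer_ex1[OF e h(1)] h by (simp del: Comp_coalg)
    moreover have "e \<cdot>\<^bsub>coalg_cat M C\<^esub> k = h \<longleftrightarrow>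
        (H\<^sub>\<sigma> (fst e), adjunct (fst y) e, y) \<cdot>\<^bsub>coalg_cat N D\<^esub> amap (H_sigma N H \<sigma>) k = f"
      if "k \<in> hom (coalg_cat M C) w (fst e)" for k
    proof -
      have k: "k \<in> Arr (coalg_cat M C)" "fst k = w" "snd (snd k) = fst e"
        using that by (simp_all add: hom_iff)
      have "(H\<^sub>\<sigma> (fst k), adjunct (fst y) h, y) = f"
        unfolding k(2) adj_h by (rule f_eq[symmetric])
      then show ?thesis
        using factor_iff[OF e_arr y k(1,3) h(1) _ h(3)] h(2) k(2) by simp
    qed
    ultimately show ?thesis
      by metis
  qed
  then show ?thesis
    unfolding universal_arrow_def using e_arr p by (simp add: hom_iff)
qed

text \<open>A morphism of \<open>D\<close>-coalgebras \<open>f\<close> into the cofree coalgebra on \<open>Y\<close> is determined by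
  \<open>\<epsilon>\<^sub>Y \<circ> f\<close>, and \<open>\<epsilon>\<^sub>Y \<circ> \<sigma>'\<^sub>Y \<circ> H k\<close> is the adjunct of \<open>k\<close>. So solving \<open>\<sigma>'\<^sub>Y \<circ> H k = f\<close> amounts to
  finding the unique \<open>k\<close> with adjunct \<open>\<epsilon>\<^sub>Y \<circ> f\<close>.\<close>

lemma conj_universal_arrow:
  assumes Y: "Y \<in> Obj N"
  shows "universal_arrow (coalg_cat M C) (coalg_cat N D) (H_sigma N H \<sigma>)
    (cofree C (omap K Y)) (cofree D Y) (H\<^sub>\<sigma> (cofree C (omap K Y)), \<sigma>' Y, cofree D Y)"
    (is "universal_arrow _ _ _ ?x _ ?p")
proof -
  have p: "?p \<in> Arr (coalg_cat N D)"
    using Y conj_comult[OF Y] by (simp add: colax.D.coalg_triple_iff)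
  have "\<exists>!k. k \<in> hom (coalg_cat M C) w ?x \<and> ?p \<cdot>\<^bsub>coalg_cat N D\<^esub> amap (H_sigma N H \<sigma>) k = f"
    if w: "w \<in> coalgebras M C" and f: "f \<in> hom (coalg_cat N D) (H\<^sub>\<sigma> w) (cofree D Y)" for w f
  proof -
    have f_arr: "f \<in> Arr (coalg_cat N D)" "fst f = H\<^sub>\<sigma> w" "snd (snd f) = cofree D Y"
      using f by (simp_all add: hom_iff)
    have f_eq: "f = (H\<^sub>\<sigma> w, und f, cofree D Y)"
      using f_arr by (simp add: prod_eq_iff)
    have f_und: "und f \<in> Arr N" "Dom N (und f) = omap H (fst w)" "Cod N (und f) = omap (fn D) Y"
      using colax.D.coalg_arrD[OF f_arr(1)] f_arr by simp_all
    let ?g = "\<epsilon>\<^bsub>D\<^esub> Y \<cdot>\<^bsub>N\<^esub> und f"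
    have g: "?g \<in> Arr N" "Dom N ?g = omap H (fst w)" "Cod N ?g = Y"
      using f_und Y by simp_all
    have iff: "?p \<cdot>\<^bsub>coalg_cat N D\<^esub> amap (H_sigma N H \<sigma>) k = f \<longleftrightarrow> adjunct Y k = ?g"
      if "k \<in> hom (coalg_cat M C) w ?x" for k
    proof -
      from that have k: "k \<in> Arr (coalg_cat M C)" "fst k = w" "snd (snd k) = ?x"
        by (simp_all add: hom_iff)
      let ?pk = "?p \<cdot>\<^bsub>coalg_cat N D\<^esub> amap (H_sigma N H \<sigma>) k"
      have pk: "?pk \<in> Arr (coalg_cat N D)"
        using colax.D.coalg.comp_arr(1)[OF H\<sigma>.map_arr(1)[OF k(1)] p] k by simp
      have "\<epsilon>\<^bsub>D\<^esub> Y \<cdot>\<^bsub>N\<^esub> und ?pk = adjunct Y k"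
        using k Y adj.F.B.comp_eq_extend[OF conj_counit[OF Y]] colax.C.coalg_arrD[OF k(1)]
        by (simp add: adjunct_def adj.F.map_comp)
      moreover have "?pk = f \<longleftrightarrow> und ?pk = und f"
        using k f_arr by (auto simp: prod_eq_iff)
      moreover have "und ?pk = und f \<longleftrightarrow> \<epsilon>\<^bsub>D\<^esub> Y \<cdot>\<^bsub>N\<^esub> und ?pk = ?g"
      proof
        have "fst ?pk = fst f" "snd (snd ?pk) = cofree D Y"
          using k f_arr by simp_all
        note recover = colax.D.transpose_counit[OF pk this(2) Y, unfolded this(1)]
          colax.D.transpose_counit[OF f_arr(1,3) Y]
        assume same: "\<epsilon>\<^bsub>D\<^esub> Y \<cdot>\<^bsub>N\<^esub> und ?pk = ?g"
        show "und ?pk = und f"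
          by (rule trans[OF recover(1)[symmetric] recover(2)[folded same]])
      qed simp
      ultimately show ?thesis
        by simp
    qed
    obtain k where k: "k \<in> Arr (coalg_cat M C)" "fst k = w" "snd (snd k) = ?x" "adjunct Y k = ?g"
      using adjunct_surj[OF g w] by fastforce
    have "\<exists>!k. k \<in> hom (coalg_cat M C) w ?x \<and> adjunct Y k = ?g"
    proof (rule ex1I[of _ k])
      fix k' assume "k' \<in> hom (coalg_cat M C) w ?x \<and> adjunct Y k' = ?g"
      then show "k' = k"
        using k Y by (intro adjunct_inj[of k' Y k]) (simp_all add: hom_iff)
    qed (use k in \<open>simp add: hom_iff\<close>)
    then show ?thesis
      using iff by metis
  qed
  then show ?thesis
    unfolding universal_arrow_def using Y p by (simp add: hom_iff)
qed

lemma choice_equalizer: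
  assumes "equalizer_choice M C N D K \<tau> e" "y \<in> coalgebras N D"
  shows "is_equalizer (coalg_cat M C) (e y) (Left y) (Right y)"
    "e y \<in> Arr (coalg_cat M C)" "snd (snd (e y)) = cofree C (omap K (fst y))"
proof -
  show eq: "is_equalizer (coalg_cat M C) (e y) (Left y) (Right y)"
    using assms by (simp add: equalizer_choice_def)
  show "e y \<in> Arr (coalg_cat M C)" "snd (snd (e y)) = cofree C (omap K (fst y))"
    using colax.C.coalg.equalizerD[OF eq] by simp_all
qed

lemma K_tau_counit_eq:
  assumes "equalizer_choice M C N D K \<tau> e" "y \<in> coalgebras N D"
  shows "K_tau_counit M C N H K \<xi> \<sigma> e y = (H\<^sub>\<sigma> (fst (e y)), adjunct (fst y) (e y), y)"
  using choice_equalizer[OF assms] colax.C.coalg_arrD[of "e y"] assms(2)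
  by (simp add: K_tau_counit_def K_tau_obj_def adjunct_def case_prod_beta adj.F.map_comp)

lemma counit_universal_arrow:
  assumes "equalizer_choice M C N D K \<tau> e" "y \<in> coalgebras N D"
  shows "universal_arrow (coalg_cat M C) (coalg_cat N D) (H_sigma N H \<sigma>)
    (fst (e y)) y (K_tau_counit M C N H K \<xi> \<sigma> e y)"
  unfolding K_tau_counit_eq[OF assms]
  by (rule equalizer_universal_arrow[OF assms(2) choice_equalizer(1)[OF assms]])

text \<open>The action of \<open>K\<^sup>\<tau>\<close> on arrows and the unit are both defined as the arrow \<open>k\<close> of this lemma, for
  two different \<open>h\<close>.\<close>

lemma lift_along_choice:
  assumes e: "equalizer_choice M C N D K \<tau> e" and y: "y \<in> coalgebras N D"
    and w: "w \<in> coalgebras M C"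
    and h: "h \<in> Arr (coalg_cat M C)" "fst h = w" "snd (snd h) = cofree C (omap K (fst y))"
    and adj_h: "(H\<^sub>\<sigma> w, adjunct (fst y) h, y) \<in> Arr (coalg_cat N D)"
  defines "k \<equiv> THE k. k \<in> hom (coalg_cat M C) w (fst (e y)) \<and> e y \<cdot>\<^bsub>coalg_cat M C\<^esub> k = h"
  shows "k \<in> hom (coalg_cat M C) w (fst (e y))"
    and "K_tau_counit M C N H K \<xi> \<sigma> e y \<cdot>\<^bsub>coalg_cat N D\<^esub> amap (H_sigma N H \<sigma>) k
      = (H\<^sub>\<sigma> w, adjunct (fst y) h, y)"
proof -
  note ey = choice_equalizer[OF e y]
  have "Left y \<cdot>\<^bsub>coalg_cat M C\<^esub> h = Right y \<cdot>\<^bsub>coalg_cat M C\<^esub> h"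
    using equalizes_iff_coalg_arr[OF h(1,3) y] adj_h h(2) by blast
  then have "\<exists>!k. k \<in> hom (coalg_cat M C) w (fst (e y)) \<and> e y \<cdot>\<^bsub>coalg_cat M C\<^esub> k = h"
    using colax.C.coalg.equalizer_ex1[OF ey(1) h(1)] h(2,3) by (simp del: Comp_coalg)
  from theI'[OF this] have k: "k \<in> hom (coalg_cat M C) w (fst (e y))" "e y \<cdot>\<^bsub>coalg_cat M C\<^esub> k = h"
    unfolding k_def by blast+
  show "k \<in> hom (coalg_cat M C) w (fst (e y))"
    by (rule k(1))
  have k_arr: "k \<in> Arr (coalg_cat M C)" "fst k = w" "snd (snd k) = fst (e y)"
    using k(1) by (simp_all add: hom_iff)
  show "K_tau_counit M C N H K \<xi> \<sigma> e y \<cdot>\<^bsub>coalg_cat N D\<^esub> amap (H_sigma N H \<sigma>) k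
      = (H\<^sub>\<sigma> w, adjunct (fst y) h, y)"
    using factor_iff[OF ey(2,3) y k_arr(1,3) h(1) trans[OF h(2) k_arr(2)[symmetric]] h(3)] k(2)
    unfolding K_tau_counit_eq[OF e y] k_arr(2) by blast
qed

lemma K_tau_adjunction:
  assumes e: "equalizer_choice M C N D K \<tau> e"
  shows "adjunction (coalg_cat M C) (coalg_cat N D) (H_sigma N H \<sigma>) (K_tau M C K e)
    (K_tau_unit M C N H K \<eta> \<sigma> e) (K_tau_counit M C N H K \<xi> \<sigma> e)"
proof (rule H\<sigma>.adjunction_of_universal_arrows)
  fix y assume "y \<in> Obj (coalg_cat N D)"
  then show "universal_arrow (coalg_cat M C) (coalg_cat N D) (H_sigma N H \<sigma>)
      (omap (K_tau M C K e) y) y (K_tau_counit M C N H K \<xi> \<sigma> e y)"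
    using counit_universal_arrow[OF e] by (simp add: K_tau_def K_tau_obj_def)
next
  fix g y z assume "g \<in> hom (coalg_cat N D) y z"
  then have g: "g \<in> Arr (coalg_cat N D)" "fst g = y" "snd (snd g) = z"
    by (simp_all add: hom_iff)
  then have g_und: "und g \<in> Arr N" "Dom N (und g) = fst y" "Cod N (und g) = fst z"
    and y: "y \<in> coalgebras N D" and z: "z \<in> coalgebras N D"
    using colax.D.coalg_arrD[OF g(1)] by simp_all
  note ey = choice_equalizer[OF e y]
  \<comment> \<open>The arrow \<open>h\<close> whose factorisation defines \<open>K\<^sup>\<tau> g\<close> has as adjunct the counit followed by
    the underlying arrow of \<open>g\<close>.\<close>
  let ?Kg = "(cofree C (omap K (fst y)), amap (fn C) (amap K (und g)), cofree C (omap K (fst z)))"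
  let ?h = "?Kg \<cdot>\<^bsub>coalg_cat M C\<^esub> e y"
  have "?Kg \<in> Arr (coalg_cat M C)"
    using colax.C.cofree_map[of "amap K (und g)"] g_und by simp
  then have h: "?h \<in> Arr (coalg_cat M C)"
    by (rule colax.C.coalg.comp_arr(1)[OF ey(2)]) (simp add: ey(3))
  have adj_h: "(H\<^sub>\<sigma> (fst (e y)), adjunct (fst z) ?h, z)
      = g \<cdot>\<^bsub>coalg_cat N D\<^esub> K_tau_counit M C N H K \<xi> \<sigma> e y"
    using adjunct_map[OF ey(2,3) g_und] K_tau_counit_eq[OF e y] g by simp
  have "K_tau_counit M C N H K \<xi> \<sigma> e y \<in> hom (coalg_cat N D) (H\<^sub>\<sigma> (fst (e y))) y"
    using H\<sigma>.universal_arrowD[OF counit_universal_arrow[OF e y]] by (simp add: hom_iff)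
  then have "(H\<^sub>\<sigma> (fst (e y)), adjunct (fst z) ?h, z) \<in> Arr (coalg_cat N D)"
    unfolding adj_h using g by (intro colax.D.coalg.comp_arr(1)) (simp_all add: hom_iff)
  moreover have "fst ?h = fst (e y)" "snd (snd ?h) = cofree C (omap K (fst z))"
    by simp_all
  ultimately
  show "amap (K_tau M C K e) g \<in> hom (coalg_cat M C) (omap (K_tau M C K e) y) (omap (K_tau M C K e) z) \<and>
      K_tau_counit M C N H K \<xi> \<sigma> e z \<cdot>\<^bsub>coalg_cat N D\<^esub> amap (H_sigma N H \<sigma>) (amap (K_tau M C K e) g)
      = g \<cdot>\<^bsub>coalg_cat N D\<^esub> K_tau_counit M C N H K \<xi> \<sigma> e y"
    using lift_along_choice[OF e z colax.C.coalg_arrD(1)[OF ey(2)] h] g unfolding adj_h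
    by (simp add: K_tau_def K_tau_obj_def case_prod_beta del: Comp_coalg H_sigma_sel(4))
next
  fix x assume "x \<in> Obj (coalg_cat M C)"
  then have x: "x \<in> coalgebras M C" by simp
  then have Hx: "H\<^sub>\<sigma> x \<in> coalgebras N D" by simp
  \<comment> \<open>The arrow \<open>C \<eta> \<circ> c\<close> that defines the unit is the one whose adjunct is the identity.\<close>
  let ?h = "(x, amap (fn C) (\<eta> (fst x)) \<cdot>\<^bsub>M\<^esub> snd x, cofree C (omap K (omap H (fst x))))"
  have h: "?h \<in> Arr (coalg_cat M C)" and adj_h: "adjunct (fst (H\<^sub>\<sigma> x)) ?h = Id N (omap H (fst x))"
    using adjunct_surj[of "Id N (omap H (fst x))" x "omap H (fst x)"] x by simp_all
  have adj_h': "(H\<^sub>\<sigma> x, adjunct (fst (H\<^sub>\<sigma> x)) ?h, H\<^sub>\<sigma> x) = Id (coalg_cat N D) (H\<^sub>\<sigma> x)"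
    unfolding adj_h by simp
  have "(H\<^sub>\<sigma> x, adjunct (fst (H\<^sub>\<sigma> x)) ?h, H\<^sub>\<sigma> x) \<in> Arr (coalg_cat N D)"
    unfolding adj_h' using Hx by (intro colax.D.coalg.Id_arr(1)) simp
  moreover have "fst ?h = x" "snd (snd ?h) = cofree C (omap K (fst (H\<^sub>\<sigma> x)))"
    by simp_all
  ultimately show "K_tau_unit M C N H K \<eta> \<sigma> e x
        \<in> hom (coalg_cat M C) x (omap (K_tau M C K e) (omap (H_sigma N H \<sigma>) x)) \<and>
      K_tau_counit M C N H K \<xi> \<sigma> e (omap (H_sigma N H \<sigma>) x)
        \<cdot>\<^bsub>coalg_cat N D\<^esub> amap (H_sigma N H \<sigma>) (K_tau_unit M C N H K \<eta> \<sigma> e x)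
      = Id (coalg_cat N D) (omap (H_sigma N H \<sigma>) x)"
    using lift_along_choice[OF e Hx x h] unfolding adj_h'
    by (simp add: K_tau_def K_tau_unit_def K_tau_obj_def case_prod_beta
        del: Comp_coalg Id_coalg H_sigma_sel(4))
qed

section \<open>Equivalences and the conjugate transformation\<close>

lemma conj_invertible_iff:
  "invertible_trans N N (fn (conjugate_comonad N C H K \<eta> \<xi>)) (fn D) \<sigma>'
    \<longleftrightarrow> (\<forall>Y \<in> Obj N. iso N (\<sigma>' Y))"
  by (rule conj.invertible_iff_components_iso)

text \<open>Both the counit and \<open>\<sigma>'\<^sub>Y\<close> are universal arrows to the cofree coalgebra, so they differ by an
  isomorphism.\<close>

lemma conj_iso_of_counit_iso:
  assumes e: "equalizer_choice M C N D K \<tau> e" and Y: "Y \<in> Obj N"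
    and iso: "iso (coalg_cat N D) (K_tau_counit M C N H K \<xi> \<sigma> e (cofree D Y))"
  shows "iso N (\<sigma>' Y)"
proof -
  let ?x = "cofree C (omap K Y)" and ?y = "cofree D Y"
  let ?p = "K_tau_counit M C N H K \<xi> \<sigma> e ?y" and ?q = "(H\<^sub>\<sigma> ?x, \<sigma>' Y, ?y)"
  have y: "?y \<in> coalgebras N D"
    using Y by simp
  note p = counit_universal_arrow[OF e y] and q = conj_universal_arrow[OF Y]
  obtain u where u: "iso (coalg_cat M C) u" "Cod (coalg_cat M C) u = fst (e ?y)"
      "?p \<cdot>\<^bsub>coalg_cat N D\<^esub> amap (H_sigma N H \<sigma>) u = ?q"
    using H\<sigma>.universal_arrows_iso[OF p q] by blast
  have "u \<in> Arr (coalg_cat M C)"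
    using u(1) by (simp add: iso_def)
  then have "iso (coalg_cat N D) ?q"
    using colax.D.coalg.iso_comp[OF H\<sigma>.map_iso[OF u(1)] iso] u(2,3)
      H\<sigma>.universal_arrowD(3)[OF p] H\<sigma>.map_arr(3)[of u] by simp
  then show ?thesis
    using colax.D.iso_coalg_iff[of ?q] H\<sigma>.universal_arrowD(2)[OF q] by simp
qed

text \<open>The common retraction is \<open>C K \<epsilon>\<^sub>Y\<close>. For the first arrow this reduces, by \<open>K \<epsilon>\<^sub>Y \<circ> \<tau>\<^sub>Y = \<epsilon>\<close>, to the
  right counit law of \<open>C\<close>.\<close>

lemma pair_coreflexive:
  assumes y: "y \<in> coalgebras N D"
  shows "coreflexive M (und (Left y)) (und (Right y))"
proof -
  let ?Y = "fst y"
  let ?r = "amap (fn C) (amap K (\<epsilon>\<^bsub>D\<^esub> ?Y))"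
  have Y: "?Y \<in> Obj N"
    using y by simp
  have "amap (fn C) (amap K (\<epsilon>\<^bsub>D\<^esub> ?Y)) \<cdot>\<^bsub>M\<^esub> amap (fn C) (\<tau> ?Y) = amap (fn C) (\<epsilon>\<^bsub>C\<^esub> (omap K ?Y))"
    using Y by (simp add: counit_comp_mate flip: colax.C.F.map_comp)
  then have "?r \<cdot>\<^bsub>M\<^esub> und (Left y) = Id M (omap (fn C) (omap K ?Y))"
    using Y adj.F.A.comp_eq_extend[of ?r "amap (fn C) (\<tau> ?Y)"] by (simp add: colax.C.counit_right)
  moreover have "?r \<cdot>\<^bsub>M\<^esub> und (Right y) = Id M (omap (fn C) (omap K ?Y))"
    using y by (simp add: colax.D.coalgebra_laws flip: colax.C.F.map_comp adj.G.map_comp)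
  ultimately show ?thesis
    using y unfolding coreflexive_def parallel_def
    by (intro conjI bexI[of _ ?r]) (simp_all add: hom_iff)
qed

text \<open>The components of \<open>\<sigma>'\<close> at \<open>Y\<close> and at \<open>D Y\<close> identify the \<open>H\<close>-image of the pair with \<open>\<delta>\<^sub>Y, D d\<close>,
  which is split by the coalgebra structure \<open>d\<close>.\<close>

lemma pair_split_cofork:
  assumes y: "y \<in> coalgebras N D" and iso: "\<forall>Y \<in> Obj N. iso N (\<sigma>' Y)"
    and s: "s \<in> Arr N" "Dom N s = omap (fn D) (fst y)" "Cod N s = omap H (omap (fn C) (omap K (fst y)))"
      "s \<cdot>\<^bsub>N\<^esub> \<sigma>' (fst y) = Id N (omap H (omap (fn C) (omap K (fst y))))"
      "\<sigma>' (fst y) \<cdot>\<^bsub>N\<^esub> s = Id N (omap (fn D) (fst y))"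
  shows "split_cofork N (s \<cdot>\<^bsub>N\<^esub> snd y) (amap H (und (Left y))) (amap H (und (Right y)))"
proof (rule adj.F.B.split_cofork_transport[OF colax.D.coalgebra_split_cofork[OF y], where s = "\<sigma>' (fst y)"
    and t = "\<sigma>' (omap (fn D) (fst y))"])
  show "\<sigma>' (omap (fn D) (fst y)) \<cdot>\<^bsub>N\<^esub> amap H (und (Left y)) = \<delta>\<^bsub>D\<^esub> (fst y) \<cdot>\<^bsub>N\<^esub> \<sigma>' (fst y)"
    using y by (simp add: conj_comp_left)
  show "\<sigma>' (omap (fn D) (fst y)) \<cdot>\<^bsub>N\<^esub> amap H (und (Right y)) = amap (fn D) (snd y) \<cdot>\<^bsub>N\<^esub> \<sigma>' (fst y)"
    using y conj.natural[of "snd y"] by simp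
qed (use y s iso in simp_all)

text \<open>Both \<open>H k\<close> and the composite of \<open>d\<close> with the inverse of \<open>\<sigma>'\<^sub>Y\<close> are equalizers of the same pair.
  The resulting isomorphism \<open>u\<close> satisfies \<open>\<sigma>'\<^sub>Y \<circ> H k = d \<circ> u\<close>, and composing with \<open>\<epsilon>\<^sub>Y\<close> shows
  that it is the adjunct of \<open>k\<close>.\<close>

lemma counit_iso_of_equalizer:
  assumes y: "y \<in> coalgebras N D" and iso: "\<forall>Y \<in> Obj N. iso N (\<sigma>' Y)"
    and k: "k \<in> Arr (coalg_cat M C)" "snd (snd k) = cofree C (omap K (fst y))"
    and eq: "is_equalizer N (amap H (und k)) (amap H (und (Left y))) (amap H (und (Right y)))"
  shows "iso N (adjunct (fst y) k)"
proof -
  let ?Y = "fst y" and ?X = "omap H (omap (fn C) (omap K (fst y)))"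
  have Y: "?Y \<in> Obj N"
    using y by simp
  then have "iso N (\<sigma>' ?Y)"
    using iso by blast
  then obtain s where s: "s \<in> Arr N" "Dom N s = omap (fn D) ?Y" "Cod N s = ?X"
      "s \<cdot>\<^bsub>N\<^esub> \<sigma>' ?Y = Id N ?X" "\<sigma>' ?Y \<cdot>\<^bsub>N\<^esub> s = Id N (omap (fn D) ?Y)"
    by (rule adj.F.B.isoE) (use Y in simp)
  note split = adj.F.B.split_cofork_is_equalizer[OF pair_split_cofork[OF y iso s]]
  obtain u where u: "iso N u" "Cod N u = ?Y" and su: "(s \<cdot>\<^bsub>N\<^esub> snd y) \<cdot>\<^bsub>N\<^esub> u = amap H (und k)"
    by (rule adj.F.B.equalizers_iso[OF split eq]) (use y s in simp)
  have u_arr: "u \<in> Arr N"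
    using u(1) by (simp add: iso_def)
  have "adjunct ?Y k = \<epsilon>\<^bsub>D\<^esub> ?Y \<cdot>\<^bsub>N\<^esub> (\<sigma>' ?Y \<cdot>\<^bsub>N\<^esub> amap H (und k))"
    using k Y adj.F.B.comp_eq_extend[OF conj_counit[OF Y]] by (simp add: adjunct_def adj.F.map_comp)
  also have "\<dots> = \<epsilon>\<^bsub>D\<^esub> ?Y \<cdot>\<^bsub>N\<^esub> (snd y \<cdot>\<^bsub>N\<^esub> u)"
    using y u(2) u_arr s adj.F.B.comp_eq_extend[OF s(5)] by (simp flip: su)
  also have "\<dots> = u"
    using y u(2) u_arr adj.F.B.comp_eq_extend[OF colax.D.coalgebra_laws(2)[OF y]] by simp
  finally show ?thesis
    using u(1) by simp
qed

text \<open>By a triangle identity \<open>H\<^sub>\<sigma>\<close> of the unit is a section of an invertible counit.\<close>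

lemma unit_iso:
  assumes e: "equalizer_choice M C N D K \<tau> e" and x: "x \<in> coalgebras M C"
    and iso: "iso (coalg_cat N D) (K_tau_counit M C N H K \<xi> \<sigma> e (H\<^sub>\<sigma> x))"
    and conservative: "conservative M N H"
  shows "iso (coalg_cat M C) (K_tau_unit M C N H K \<eta> \<sigma> e x)"
proof -
  let ?k = "K_tau_unit M C N H K \<eta> \<sigma> e x" and ?p = "K_tau_counit M C N H K \<xi> \<sigma> e (H\<^sub>\<sigma> x)"
  interpret K: adjunction "coalg_cat M C" "coalg_cat N D" "H_sigma N H \<sigma>" "K_tau M C K e"
    "K_tau_unit M C N H K \<eta> \<sigma> e" "K_tau_counit M C N H K \<xi> \<sigma> e"
    by (rule K_tau_adjunction[OF e])
  have Hx: "H\<^sub>\<sigma> x \<in> coalgebras N D"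
    using x by simp
  have k: "?k \<in> Arr (coalg_cat M C)"
    using K.unit.component_arr(1)[of x] x by simp
  have "iso (coalg_cat N D) (amap (H_sigma N H \<sigma>) ?k)"
  proof (rule colax.D.coalg.iso_section[OF iso])
    show "?p \<cdot>\<^bsub>coalg_cat N D\<^esub> amap (H_sigma N H \<sigma>) ?k = Id (coalg_cat N D) (Cod (coalg_cat N D) ?p)"
      using K.triangle_left[of x] K.counit.component_arr(3)[of "H\<^sub>\<sigma> x"] x Hx
      by (simp del: Comp_coalg Id_coalg H_sigma_sel(4))
    show "amap (H_sigma N H \<sigma>) ?k \<in> Arr (coalg_cat N D)"
      by (rule H\<sigma>.map_arr(1)[OF k])
    show "Cod (coalg_cat N D) (amap (H_sigma N H \<sigma>) ?k) = Dom (coalg_cat N D) ?p"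
      using H\<sigma>.map_arr(3)[OF k] K.unit.component_arr(3)[of x] K.counit.component_arr(2)[of "H\<^sub>\<sigma> x"] x Hx
      by (simp del: H_sigma_sel(4))
  qed
  then have "iso N (amap H (und ?k))"
    using colax.D.iso_coalg_iff[OF H\<sigma>.map_arr(1)[OF k]] by simp
  then show ?thesis
    using conservative k colax.C.iso_coalg_iff[OF k] colax.C.coalg_arrD[OF k]
    by (simp add: conservative_def)
qed

end

theorem theorem2p17:
  fixes M :: "('o, 'a) cat" and N :: "('p, 'b) cat"
    and H :: "('o, 'a, 'p, 'b) func" and K :: "('p, 'b, 'o, 'a) func"
    and \<eta> :: "'o \<Rightarrow> 'a" and \<xi> :: "'p \<Rightarrow> 'b"
    and C :: "('o, 'a) comonad_data" and D :: "('p, 'b) comonad_data"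
    and \<sigma> :: "'o \<Rightarrow> 'b"
    and \<tau> :: "'p \<Rightarrow> 'a" and \<sigma>' :: "'p \<Rightarrow> 'b"
  assumes adj: "adjunction M N H K \<eta> \<xi>"
    and comonad_C: "comonad M C"
    and comonad_D: "comonad N D"
    and colax: "colax_comonad_morphism M C N D H \<sigma>"
    and tau: "\<tau> = mate M C D K \<eta> \<xi> \<sigma>"
    and sigma': "\<sigma>' = conjugate_trans N D K \<xi> \<sigma>"
    and a: "\<And>f g. coreflexive M f g \<Longrightarrow> split_by M N H f g \<Longrightarrow> \<exists>e. is_equalizer M e f g"
    and b: "\<And>f g. coreflexive M f g \<Longrightarrow> split_by M N H f g \<Longrightarrow> preserves_equalizer M N H f g"
    and c: "conservative M N H"
    and d: "\<And>f g. coreflexive M f g \<Longrightarrow> split_by M N H f g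
              \<Longrightarrow> preserves_equalizer M M (fn C) f g \<and>
                  preserves_equalizer M M (fn C \<circ>\<^sub>F fn C) f g"
  shows "(K_tau_defined M C N D K \<tau> \<and>
          (\<forall>e. equalizer_choice M C N D K \<tau> e \<longrightarrow>
             adjoint_equivalence (coalg_cat M C) (coalg_cat N D)
               (H_sigma N H \<sigma>) (K_tau M C K e)
               (K_tau_unit M C N H K \<eta> \<sigma> e) (K_tau_counit M C N H K \<xi> \<sigma> e)))
         \<longleftrightarrow> invertible_trans N N (fn (conjugate_comonad N C H K \<eta> \<xi>)) (fn D) \<sigma>'"
proof -
  interpret colax_adjunction M N H K \<eta> \<xi> C D \<sigma>
    using adj colax by (rule colax_adjunction.intro)
  show ?thesis
    unfolding tau sigma' conj_invertible_iff
  proof (intro iffI conjI ballI allI impI)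
    fix Y assume Y: "Y \<in> Obj N"
    assume equiv: "K_tau_defined M C N D K (mate M C D K \<eta> \<xi> \<sigma>) \<and>
      (\<forall>e. equalizer_choice M C N D K (mate M C D K \<eta> \<xi> \<sigma>) e \<longrightarrow>
        adjoint_equivalence (coalg_cat M C) (coalg_cat N D) (H_sigma N H \<sigma>) (K_tau M C K e)
          (K_tau_unit M C N H K \<eta> \<sigma> e) (K_tau_counit M C N H K \<xi> \<sigma> e))"
    then obtain e where e: "equalizer_choice M C N D K (mate M C D K \<eta> \<xi> \<sigma>) e"
      unfolding K_tau_defined_def equalizer_choice_def by (metis bchoice)
    then interpret K: adjunction "coalg_cat M C" "coalg_cat N D" "H_sigma N H \<sigma>" "K_tau M C K e"
      "K_tau_unit M C N H K \<eta> \<sigma> e" "K_tau_counit M C N H K \<xi> \<sigma> e"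
      by (rule K_tau_adjunction)
    have "invertible_trans (coalg_cat N D) (coalg_cat N D) (H_sigma N H \<sigma> \<circ>\<^sub>F K_tau M C K e) idF
        (K_tau_counit M C N H K \<xi> \<sigma> e)"
      using equiv e by (simp add: adjoint_equivalence_def)
    then have "iso (coalg_cat N D) (K_tau_counit M C N H K \<xi> \<sigma> e (cofree D Y))"
      unfolding K.counit.invertible_iff_components_iso using Y by simp
    then show "iso N (conjugate_trans N D K \<xi> \<sigma> Y)"
      by (rule conj_iso_of_counit_iso[OF e Y])
  next
    assume iso: "\<forall>Y \<in> Obj N. iso N (conjugate_trans N D K \<xi> \<sigma> Y)"
    \<comment> \<open>Invertibility of \<open>\<sigma>'\<close> brings every defining pair under the hypotheses on equalizers.\<close>
    have split: "split_by M N H (und (Left y)) (und (Right y))" if y: "y \<in> coalgebras N D" for y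
    proof -
      have "iso N (conjugate_trans N D K \<xi> \<sigma> (fst y))"
        using iso y by simp
      then obtain s where "s \<in> Arr N" "Dom N s = omap (fn D) (fst y)"
          "Cod N s = omap H (omap (fn C) (omap K (fst y)))"
          "s \<cdot>\<^bsub>N\<^esub> conjugate_trans N D K \<xi> \<sigma> (fst y) = Id N (omap H (omap (fn C) (omap K (fst y))))"
          "conjugate_trans N D K \<xi> \<sigma> (fst y) \<cdot>\<^bsub>N\<^esub> s = Id N (omap (fn D) (fst y))"
        by (rule adj.F.B.isoE) (use y in simp)
      from pair_split_cofork[OF y iso this] show ?thesis
        using pair_coreflexive[OF y] unfolding split_by_def coreflexive_def by blast
    qed
    have equalizer: "\<exists>q. is_equalizer M q (und (Left y)) (und (Right y)) \<and>
        is_equalizer M (amap (fn C) q) (amap (fn C) (und (Left y))) (amap (fn C) (und (Right y))) \<and>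
        is_equalizer M (amap (fn C \<circ>\<^sub>F fn C) q) (amap (fn C \<circ>\<^sub>F fn C) (und (Left y)))
          (amap (fn C \<circ>\<^sub>F fn C) (und (Right y)))" if y: "y \<in> coalgebras N D" for y
    proof -
      note pair = pair_coreflexive[OF y] split[OF y]
      obtain q where "is_equalizer M q (und (Left y)) (und (Right y))"
        using a[OF pair] by blast
      then show ?thesis
        using d[OF pair] unfolding preserves_equalizer_def by blast
    qed
    show "K_tau_defined M C N D K (mate M C D K \<eta> \<xi> \<sigma>)"
      unfolding K_tau_defined_def
    proof
      fix y assume y: "y \<in> coalgebras N D"
      obtain q where q: "is_equalizer M q (und (Left y)) (und (Right y))"
        "is_equalizer M (amap (fn C) q) (amap (fn C) (und (Left y))) (amap (fn C) (und (Right y)))"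
        "is_equalizer M (amap (fn C \<circ>\<^sub>F fn C) q) (amap (fn C \<circ>\<^sub>F fn C) (und (Left y)))
          (amap (fn C \<circ>\<^sub>F fn C) (und (Right y)))"
        using equalizer[OF y] by blast
      show "\<exists>e. is_equalizer (coalg_cat M C) e (Left y) (Right y)"
        by (rule colax.C.coalg_equalizer_lift[OF left_arr[OF y] right_arr[OF y] _ _ q]) (simp, simp, rule exI)
    qed
    fix e assume e: "equalizer_choice M C N D K (mate M C D K \<eta> \<xi> \<sigma>) e"
    interpret K: adjunction "coalg_cat M C" "coalg_cat N D" "H_sigma N H \<sigma>" "K_tau M C K e"
      "K_tau_unit M C N H K \<eta> \<sigma> e" "K_tau_counit M C N H K \<xi> \<sigma> e"
      by (rule K_tau_adjunction[OF e])
    have counit: "iso (coalg_cat N D) (K_tau_counit M C N H K \<xi> \<sigma> e y)"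
      if y: "y \<in> coalgebras N D" for y
    proof -
      note ey = choice_equalizer[OF e y]
      obtain q where q: "is_equalizer M q (und (Left y)) (und (Right y))"
        "is_equalizer M (amap (fn C) q) (amap (fn C) (und (Left y))) (amap (fn C) (und (Right y)))"
        "is_equalizer M (amap (fn C \<circ>\<^sub>F fn C) q) (amap (fn C \<circ>\<^sub>F fn C) (und (Left y)))
          (amap (fn C \<circ>\<^sub>F fn C) (und (Right y)))"
        using equalizer[OF y] by blast
      have "is_equalizer M (und (e y)) (und (Left y)) (und (Right y))"
        by (rule colax.C.coalg_equalizer_und[OF left_arr[OF y] right_arr[OF y] _ _ q ey(1)]) simp_all
      then have "is_equalizer N (amap H (und (e y))) (amap H (und (Left y))) (amap H (und (Right y)))"
        using b[OF pair_coreflexive[OF y] split[OF y]] unfolding preserves_equalizer_def by blast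
      then have "iso N (adjunct (fst y) (e y))"
        by (rule counit_iso_of_equalizer[OF y iso ey(2,3)])
      then show ?thesis
        using colax.D.iso_coalg_iff[of "K_tau_counit M C N H K \<xi> \<sigma> e y"]
          H\<sigma>.universal_arrowD(2)[OF counit_universal_arrow[OF e y]] K_tau_counit_eq[OF e y] by simp
    qed
    have unit: "iso (coalg_cat M C) (K_tau_unit M C N H K \<eta> \<sigma> e x)" if x: "x \<in> coalgebras M C" for x
      by (rule unit_iso[OF e x counit c]) (use x in simp)
    show "adjoint_equivalence (coalg_cat M C) (coalg_cat N D) (H_sigma N H \<sigma>) (K_tau M C K e)
        (K_tau_unit M C N H K \<eta> \<sigma> e) (K_tau_counit M C N H K \<xi> \<sigma> e)"
      unfolding adjoint_equivalence_def
        K.unit.invertible_iff_components_iso K.counit.invertible_iff_components_iso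
      using K_tau_adjunction[OF e] unit counit by simp
  qed
qed

end
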